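(* Let $P$ be a set of $n\geq 2$ points in general position in the plane $\mathbb{R}^2$. Then the edge disjointness graph $D(P)$ is hamiltonian if and only if $n\geq 6$ and $P$ does not have the same order type as a set of $6$ points in convex position.
   Context: A set of points is in general position if no three are collinear. A segment of $P$ is a closed straight line segment whose two endpoints are distinct points of $P$. The edge disjointness graph $D(P)$ has as vertices all $\binom{n}{2}$ segments of $P$, two segments being adjacent iff they are disjoint (as closed sets). A graph is hamiltonian if it contains a cycle (with at least $3$ vertices) passing through every vertex. Two finite point sets $P,Q$ in general position have the same order type if there is a bijection $\gamma:P\to Q$ such that for every ordered triple $abc$ of points of $P$, the sign of the determinant $\det\begin{pmatrix}1&x_a&y_a\\1&x_b&y_b\\1&x_c&y_c\end{pmatrix}$ equals the corresponding sign for $\gamma(a)\gamma(b)\gamma(c)$. *)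

theory Defs
  imports "HOL-Analysis.Analysis" "Graph_Theory.Pair_Digraph"
begin

definition general_position :: "(real^2) set \<Rightarrow> bool" where
  "general_position P \<longleftrightarrow>
     (\<forall>a\<in>P. \<forall>b\<in>P. \<forall>c\<in>P. a \<noteq> b \<and> a \<noteq> c \<and> b \<noteq> c \<longrightarrow> \<not> collinear {a, b, c})"

definition convex_position :: "(real^2) set \<Rightarrow> bool" where
  "convex_position P \<longleftrightarrow> (\<forall>p\<in>P. p \<notin> convex hull (P - {p}))"

definition orientation :: "real^2 \<Rightarrow> real^2 \<Rightarrow> real^2 \<Rightarrow> real" where
  "orientation a b c =
     sgn (det (vector [vector [1, a$1, a$2],
                       vector [1, b$1, b$2],
                       vector [1, c$1, c$2]] :: real^3^3))"

definition same_order_type :: "(real^2) set \<Rightarrow> (real^2) set \<Rightarrow> bool" where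
  "same_order_type P Q \<longleftrightarrow>
     (\<exists>\<gamma>. bij_betw \<gamma> P Q \<and>
       (\<forall>a\<in>P. \<forall>b\<in>P. \<forall>c\<in>P. orientation a b c = orientation (\<gamma> a) (\<gamma> b) (\<gamma> c)))"

definition segments :: "(real^2) set \<Rightarrow> (real^2) set set" where
  "segments P = {closed_segment a b | a b. a \<in> P \<and> b \<in> P \<and> a \<noteq> b}"

text \<open>Undirected simple graphs are represented, as usual in this graph library, by loop-free
  symmetric digraphs: each edge is a pair of opposite arcs.\<close>

definition edge_disjointness_graph :: "(real^2) set \<Rightarrow> (real^2) set pair_pre_digraph" where
  "edge_disjointness_graph P =
     \<lparr> pverts = segments P,
       parcs = {(S, T). S \<in> segments P \<and> T \<in> segments P \<and> S \<inter> T = {}} \<rparr>"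

text \<open>The library predicate \<open>cycle\<close> also accepts the closed walk \<open>u, v, u\<close> along a single edge of
  a symmetric digraph. The bound on the length excludes it, so that what remains are exactly
  the cycles of the underlying undirected graph.\<close>

definition hamiltonian :: "'a pair_pre_digraph \<Rightarrow> bool" where
  "hamiltonian G \<longleftrightarrow>
     (\<exists>p. pre_digraph.cycle (with_proj G) p \<and> length p \<ge> 3 \<and> fst ` set p = pverts G)"

lemma segments_eq_image:
  "segments P = (\<lambda>e. convex hull e) ` {e. e \<subseteq> P \<and> card e = 2}"
proof -
  have "{e. e \<subseteq> P \<and> card e = 2} = {{a, b} | a b. a \<in> P \<and> b \<in> P \<and> a \<noteq> b}"
    by (auto simp: card_2_iff)
  then show ?thesis
    by (auto simp: segments_def segment_convex_hull)
qed

lemma finite_segments: "finite P \<Longrightarrow> finite (segments P)"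
  unfolding segments_eq_image by (auto intro!: finite_imageI)

lemma card_segments:
  assumes "finite P"
  shows "card (segments P) = card P choose 2"
proof -
  have "inj_on (\<lambda>e. convex hull e) {e. e \<subseteq> P \<and> card e = 2}"
    by (rule inj_onI) (auto simp: card_2_iff simp flip: segment_convex_hull)
  then show ?thesis
    unfolding segments_eq_image using assms by (simp add: card_image n_subsets)
qed

lemma pair_graph_edge_disjointness_graph:
  assumes "finite P"
  shows "pair_graph (edge_disjointness_graph P)"
proof
  let ?G = "edge_disjointness_graph P"
  show "finite (pverts ?G)"
    using assms by (simp add: edge_disjointness_graph_def finite_segments)
  show "finite (parcs ?G)"
    by (rule finite_subset[of _ "segments P \<times> segments P"])
      (use assms in \<open>auto simp: edge_disjointness_graph_def finite_segments\<close>)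
  show "symmetric (with_proj ?G)"
    by (auto simp: symmetric_def edge_disjointness_graph_def sym_def)
qed (auto simp: edge_disjointness_graph_def segments_def simp del: closed_segment_eq)

end

theory Submission
  imports Defs
begin

text \<open>
  If a cycle misses a vertex h and cannot be enlarged by it, then h together with the successors of
  its neighbours on the cycle is independent. An independent set of D(P) is a family of pairwise
  intersecting segments, hence has at most n members. Now remove a point p and take a hamiltonian
  cycle of the rest. The line through p and x leaves a and b points on its two sides, with
  a + b = n - 2, and all segments inside either side avoid px. For n at least 9 these are at least n
  segments, so the segments px can be inserted one after the other.

  For n = 6, 7, 8 only the orientations matter. Sorted around a hull vertex, the points give a sign
  pattern with few constraints, and for each n a short list of cycles contains a hamiltonian
  one for every admissible pattern; the only exception is the all-positive pattern for n = 6, which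
  means convex position. In the remaining cases, D(P) is (a subgraph of) a small explicit graph, for
  n = 5 the Petersen graph, and exhaustive search finds no hamiltonian cycle.
\<close>

section \<open>Cycles as lists\<close>

definition cyclic :: "('a \<Rightarrow> 'a \<Rightarrow> bool) \<Rightarrow> 'a list \<Rightarrow> bool" where
  "cyclic R xs \<longleftrightarrow> xs \<noteq> [] \<and> successively R xs \<and> R (last xs) (hd xs)"

definition hamiltonian_on :: "('a \<Rightarrow> 'a \<Rightarrow> bool) \<Rightarrow> 'a set \<Rightarrow> bool" where
  "hamiltonian_on R V \<longleftrightarrow> (\<exists>xs. distinct xs \<and> set xs = V \<and> 3 \<le> length xs \<and> cyclic R xs)"

text \<open>Bridge between the arc walks of the library and lists of vertices: a walk is recorded by
  the tails of its arcs, with its end appended.\<close>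

lemma successively_cas:
  assumes "set p \<subseteq> parcs G" "pre_digraph.cas (with_proj G) u p v"
  shows "successively (\<lambda>x y. (x, y) \<in> parcs G) (map fst p @ [v]) \<and> hd (map fst p @ [v]) = u
    \<and> pre_digraph.awalk_verts (with_proj G) u p = map fst p @ [v]"
  using assms
proof (induction p arbitrary: u)
  case (Cons e p)
  then show ?case
    by (cases e) (auto simp: pre_digraph.cas.simps pre_digraph.awalk_verts.simps successively_Cons)
qed (auto simp: pre_digraph.cas.simps pre_digraph.awalk_verts.simps)

lemma cas_zip:
  assumes "xs \<noteq> []" "successively (\<lambda>x y. (x, y) \<in> parcs G) (xs @ [v])"
  shows "pre_digraph.cas (with_proj G) (hd xs) (zip xs (tl xs @ [v])) v
    \<and> set (zip xs (tl xs @ [v])) \<subseteq> parcs G"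
  using assms
proof (induction xs)
  case (Cons x xs)
  then show ?case
    by (cases xs) (auto simp: pre_digraph.cas.simps)
qed simp

lemma hamiltonian_iff_hamiltonian_on:
  "hamiltonian G \<longleftrightarrow> hamiltonian_on (\<lambda>x y. (x, y) \<in> parcs G) (pverts G)" (is "_ \<longleftrightarrow> hamiltonian_on ?R _")
proof
  assume "hamiltonian G"
  then obtain p u where p: "u \<in> pverts G" "set p \<subseteq> parcs G" "pre_digraph.cas (with_proj G) u p u"
      "distinct (tl (pre_digraph.awalk_verts (with_proj G) u p))" "3 \<le> length p" "fst ` set p = pverts G"
    by (auto simp: hamiltonian_def pre_digraph.cycle_def pre_digraph.awalk_def)
  then have "p \<noteq> []" by auto
  have "successively ?R (map fst p @ [u])" "hd (map fst p @ [u]) = u" "distinct (tl (map fst p @ [u]))"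
    using successively_cas[OF p(2,3)] p(4) by auto
  moreover obtain e q where "p = e # q" using \<open>p \<noteq> []\<close> by (cases p) auto
  ultimately have "distinct (map fst p)" "cyclic ?R (map fst p)"
    unfolding cyclic_def successively_append_iff by (simp_all split: if_splits)
  then show "hamiltonian_on ?R (pverts G)"
    using p(5,6) unfolding hamiltonian_on_def by (intro exI[of _ "map fst p"]) auto
next
  assume "hamiltonian_on ?R (pverts G)"
  then obtain xs where xs: "distinct xs" "set xs = pverts G" "3 \<le> length xs" "cyclic ?R xs"
    by (auto simp: hamiltonian_on_def)
  \<comment> \<open>Each vertex is paired with its cyclic successor; these pairs are the arcs of the
    closed walk.\<close>
  define p where "p = zip xs (tl xs @ [hd xs])"
  have ne: "xs \<noteq> []" using xs by (auto simp: cyclic_def)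
  have succ: "successively ?R (xs @ [hd xs])"
    using xs(4) by (auto simp: cyclic_def successively_append_iff)
  have len: "length p = length xs" using ne by (auto simp: p_def)
  have fst: "map fst p = xs" using ne unfolding p_def by (intro map_fst_zip) auto
  have p: "pre_digraph.cas (with_proj G) (hd xs) p (hd xs)" "set p \<subseteq> parcs G"
    using cas_zip[OF ne succ] by (auto simp: p_def)
  have "distinct (tl (pre_digraph.awalk_verts (with_proj G) (hd xs) p))"
    using successively_cas[OF p(2,1)] fst xs(1) ne by (cases xs) auto
  then have "pre_digraph.cycle (with_proj G) p"
    unfolding pre_digraph.cycle_def pre_digraph.awalk_def
    using p ne xs(2,3) len by (intro exI[of _ "hd xs"]) auto
  moreover have "fst ` set p = pverts G"
    using fst xs(2) by (metis list.set_map)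
  ultimately show "hamiltonian G"
    unfolding hamiltonian_def using xs(3) len by auto
qed

lemma hamiltonian_on_image:
  assumes "inj_on f V" "\<And>x y. x \<in> V \<Longrightarrow> y \<in> V \<Longrightarrow> R x y \<Longrightarrow> S (f x) (f y)" "hamiltonian_on R V"
  shows "hamiltonian_on S (f ` V)"
proof -
  obtain xs where xs: "distinct xs" "set xs = V" "3 \<le> length xs" "cyclic R xs"
    using assms(3) by (auto simp: hamiltonian_on_def)
  then have "cyclic S (map f xs)"
    unfolding cyclic_def
    by (auto simp: successively_map last_map hd_map assms(2) intro!: successively_mono[of R])
  with xs show ?thesis
    unfolding hamiltonian_on_def using assms(1)
    by (intro exI[of _ "map f xs"]) (auto simp: distinct_map)
qed

text \<open>The inverse of \<open>f\<close> is a homomorphism, so a hamiltonian cycle pulls back to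
  any relation that contains the adjacency. This reduces nonhamiltonicity of a graph to that of a
  supergraph.\<close>

lemma hamiltonian_on_bij_betw:
  assumes "bij_betw f V W" "\<And>x y. x \<in> V \<Longrightarrow> y \<in> V \<Longrightarrow> S (f x) (f y) \<Longrightarrow> R x y" "hamiltonian_on S W"
  shows "hamiltonian_on R V"
proof -
  let ?g = "the_inv_into V f"
  have "hamiltonian_on R (?g ` W)"
  proof (rule hamiltonian_on_image[OF _ _ assms(3)])
    show "inj_on ?g W"
      using assms(1) bij_betw_the_inv_into bij_betw_imp_inj_on by blast
  next
    fix x y assume "x \<in> W" "y \<in> W" "S x y"
    then show "R (?g x) (?g y)"
      using assms(1) by (intro assms(2)) (auto simp: f_the_inv_into_f_bij_betw the_inv_into_into bij_betw_def)
  qed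
  then show ?thesis
    using assms(1) by (metis bij_betw_def bij_betw_the_inv_into)
qed

lemma cyclic_append_commute: "cyclic R (xs @ ys) \<longleftrightarrow> cyclic R (ys @ xs)"
  by (cases "xs = []"; cases "ys = []") (auto simp: cyclic_def successively_append_iff)

text \<open>The two links joining \<open>xs\<close> and \<open>ys\<close> are dropped. The new cycle
  leaves \<open>xs\<close> for \<open>h\<close>, runs through \<open>ys\<close> backwards and closes
  with the chord between the two heads.\<close>

lemma cyclic_reverse_part:
  assumes "symp R" "cyclic R (xs @ ys)" "xs \<noteq> []" "ys \<noteq> []" "R h (last xs)" "R h (last ys)" "R (hd xs) (hd ys)"
  shows "cyclic R (xs @ h # rev ys)"
proof -
  have "successively R (rev ys)"
    using assms(1,2) by (auto simp: cyclic_def successively_append_iff symp_def elim!: successively_mono)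
  then show ?thesis
    using assms by (auto simp: cyclic_def successively_append_iff successively_Cons hd_rev last_rev symp_def)
qed

lemma cyclic_rotate: "cyclic R (rotate k xs) \<longleftrightarrow> cyclic R xs"
  by (metis append_take_drop_id cyclic_append_commute rotate_drop_take)

text \<open>The argument of Chvatal and Erdos: if h fits nowhere into the cycle, then the successors of
  its neighbours, together with h, form an independent set.\<close>

lemma hamiltonian_on_insert:
  assumes sym: "symp R" and irr: "irreflp_on V R" and fin: "finite V" and h: "h \<notin> V"
    and ham: "hamiltonian_on R V"
    and indep: "\<And>I. I \<subseteq> insert h V \<Longrightarrow> (\<And>x y. x \<in> I \<Longrightarrow> y \<in> I \<Longrightarrow> \<not> R x y) \<Longrightarrow>
      card I \<le> card {v \<in> V. R h v}"
    and hh: "\<not> R h h"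
  shows "hamiltonian_on R (insert h V)"
proof -
  obtain xs where xs: "distinct xs" "set xs = V" "3 \<le> length xs" "cyclic R xs"
    using ham by (auto simp: hamiltonian_on_def)
  define m where "m = length xs"
  define nxt where "nxt i = (i + 1) mod m" for i
  define N where "N = {i. i < m \<and> R h (xs ! i)}"
  define I where "I = insert h ((\<lambda>i. xs ! nxt i) ` N)"
  have m: "m \<ge> 3" using xs by (simp add: m_def)
  have nxt_if: "nxt i = (if Suc i = m then 0 else Suc i)" if "i < m" for i
    using that by (simp add: nxt_def)
  have nxt_pred: "(nxt i + (m - 1)) mod m = i" if "i < m" for i
    using that m by (auto simp: nxt_if)
  have nxt_less: "nxt i < m" for i using m by (simp add: nxt_def)
  have "inj_on nxt {..<m}"
    by (rule inj_onI) (auto simp: nxt_def mod_Suc split: if_splits)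
  then have inj: "inj_on (\<lambda>i. xs ! nxt i) N"
    using xs(1) nxt_less by (auto simp: inj_on_def N_def m_def nth_eq_iff_index_eq)
  have hI: "h \<notin> (\<lambda>i. xs ! nxt i) ` N"
    using h xs(2) nxt_less m_def nth_mem by (metis (no_types, lifting) imageE)
  have "bij_betw (\<lambda>i. xs ! i) N {v \<in> V. R h v}"
    using xs(1,2) by (auto simp: bij_betw_def inj_on_def N_def m_def nth_eq_iff_index_eq in_set_conv_nth)
  then have cardN: "card N = card {v \<in> V. R h v}" by (rule bij_betw_same_card)
  have "finite N" by (simp add: N_def)
  then have "card I = Suc (card N)"
    unfolding I_def using hI inj by (simp add: card_image)
  moreover have "I \<subseteq> insert h V"
    unfolding I_def using xs(2) nxt_less by (auto simp: m_def)
  \<comment> \<open>\<open>I\<close> has one element more than \<open>h\<close> has neighbours,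
    which exceeds the bound for independent sets.\<close>
  ultimately obtain x y where "x \<in> I" "y \<in> I" "R x y"
    using indep[of I] cardN by fastforce
  then consider i where "i \<in> N" "R h (xs ! nxt i)"
    | i j where "i \<in> N" "j \<in> N" "R (xs ! nxt i) (xs ! nxt j)"
    using hh sym unfolding I_def by (auto dest: sympD)
  then show ?thesis
  proof cases
    case 1
    \<comment> \<open>Here \<open>h\<close> is adjacent to two consecutive vertices, and the cycle
      is opened between them.\<close>
    let ?ys = "rotate (nxt i) xs"
    have "hd ?ys = xs ! nxt i"
      using nxt_less[of i] m by (simp add: hd_rotate_conv_nth m_def flip: length_greater_0_conv)
    moreover have "last ?ys = xs ! i"
    proof -
      have "last ?ys = xs ! ((nxt i + (m - 1)) mod m)"
        using m by (subst last_conv_nth) (auto simp: nth_rotate m_def)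
      also have "(nxt i + (m - 1)) mod m = i"
        using 1 nxt_pred[of i] by (simp add: N_def)
      finally show ?thesis .
    qed
    ultimately have "cyclic R (?ys @ [h])"
      using 1 m cyclic_rotate[of R "nxt i" xs] xs(4) sym
      by (auto simp: cyclic_def successively_append_iff N_def dest: sympD)
    then show ?thesis
      using xs h unfolding hamiltonian_on_def by (intro exI[of _ "?ys @ [h]"]) auto
  next
    case 2
    let ?ys = "rotate (nxt i) xs"
    \<comment> \<open>The rotated cycle runs from \<open>nxt i\<close> to \<open>i\<close>, and
      \<open>k\<close> is the position of \<open>j\<close> in it. Cutting behind that position
      leaves a piece from \<open>nxt i\<close> to \<open>j\<close> and a piece from
      \<open>nxt j\<close> to \<open>i\<close>, whose heads are adjacent.\<close>
    define k where "k = (j + m - nxt i) mod m"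
    have k: "k < m" using m by (simp add: k_def)
    have nth: "?ys ! l = xs ! ((nxt i + l) mod m)" if "l < m" for l
      using that by (simp add: nth_rotate m_def)
    have "nxt i \<noteq> nxt j"
      using 2 irr xs(2) nxt_less nth_mem by (metis irreflp_onD m_def)
    then have "i \<noteq> j" by auto
    have im: "i < m" "j < m" using 2 by (auto simp: N_def)
    have e1: "(nxt i + (m - 1)) mod m = i"
      using nxt_pred[OF im(1)] .
    have e2: "(nxt i + k) mod m = j"
      using im m nxt_less[of i] by (simp add: k_def mod_simps)
    have e3: "(nxt i + Suc k) mod m = nxt j"
      using e2 by (metis Suc_eq_plus1 add.assoc mod_add_left_eq nxt_def)
    have "k \<noteq> m - 1" using e1 e2 \<open>i \<noteq> j\<close> by auto
    then have sk: "Suc k < m" using k by auto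
    let ?A = "take (Suc k) ?ys" and ?B = "drop (Suc k) ?ys"
    have ne: "?A \<noteq> []" "?B \<noteq> []" using sk m by (auto simp: m_def)
    have "?ys ! 0 = xs ! nxt i" using m nth[of 0] nxt_less[of i] by simp
    then have A: "hd ?A = xs ! nxt i" "last ?A = xs ! j"
      using sk m nth[of k] e2 ne
      by (simp_all add: hd_conv_nth last_conv_nth m_def min_absorb2 del: take_eq_Nil take_eq_Nil2)
    have "last ?B = last ?ys" using sk by (simp add: last_drop m_def)
    also have "\<dots> = ?ys ! (m - 1)" using m by (subst last_conv_nth) (auto simp: m_def)
    also have "\<dots> = xs ! i" using nth[of "m - 1"] m e1 by simp
    finally have B: "hd ?B = xs ! nxt j" "last ?B = xs ! i"
      using sk nth[of "Suc k"] e3 by (simp_all add: hd_drop_conv_nth m_def)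
    have "cyclic R (?A @ h # rev ?B)"
      using 2 A B ne xs(4) sym by (intro cyclic_reverse_part) (auto simp: N_def cyclic_rotate)
    moreover have "distinct (?A @ h # rev ?B)"
      using xs(1,2) h by (auto simp: distinct_append set_take_disj_set_drop_if_distinct
          dest: in_set_takeD in_set_dropD)
    moreover have "set (?A @ h # rev ?B) = insert h V"
      using xs(2) by (auto simp: set_rotate dest: in_set_takeD in_set_dropD)
        (metis UnE append_take_drop_id set_append set_rotate)
    ultimately show ?thesis
      using xs(3) unfolding hamiltonian_on_def by (intro exI[of _ "?A @ h # rev ?B"]) auto
  qed
qed

section \<open>Orientation and intersection of segments\<close>

text \<open>Twice the signed area of the triangle \<open>a b c\<close>, positive when the corners
  run counterclockwise.\<close>

definition area :: "real^2 \<Rightarrow> real^2 \<Rightarrow> real^2 \<Rightarrow> real" where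
  "area a b c = (b$1 - a$1) * (c$2 - a$2) - (b$2 - a$2) * (c$1 - a$1)"

lemma orientation_eq_sgn_area: "orientation a b c = sgn (area a b c)"
  by (simp add: orientation_def area_def det_3 algebra_simps)

lemma area_rotate: "area b c a = area a b c"
  by (simp add: area_def algebra_simps)

lemma area_swap: "area b a c = - area a b c" "area a c b = - area a b c"
  by (simp_all add: area_def algebra_simps)

lemma area_same [simp]: "area a a b = 0" "area a b a = 0" "area a b b = 0"
  by (simp_all add: area_def)

lemma area_convex_combination:
  "area a b ((1 - t) *\<^sub>R c + t *\<^sub>R d) = (1 - t) * area a b c + t * area a b d"
  by (simp add: area_def algebra_simps)

lemma collinear_if_area_eq_0:
  assumes "area a b c = 0"
  shows "collinear {a, b, c}"
proof -
  have *: "(b$1 - c$1) * (a$2 - c$2) = (b$2 - c$2) * (a$1 - c$1)"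
    using assms by (simp add: area_def algebra_simps)
  consider "a = c" | "a$1 \<noteq> c$1" | "a$2 \<noteq> c$2"
    by (auto simp: vec_eq_iff forall_2)
  then have "a = c \<or> (\<exists>u. b - c = u *\<^sub>R (a - c))"
  proof cases
    case 2
    then have "b - c = ((b$1 - c$1) / (a$1 - c$1)) *\<^sub>R (a - c)"
      using * by (simp add: vec_eq_iff forall_2)
    then show ?thesis by blast
  next
    case 3
    then have "b - c = ((b$2 - c$2) / (a$2 - c$2)) *\<^sub>R (a - c)"
      using * by (simp add: vec_eq_iff forall_2 flip: *)
    then show ?thesis by blast
  qed simp
  then have "a = c \<or> (\<exists>u. b = u *\<^sub>R a + (1 - u) *\<^sub>R c)"
    by (metis (no_types, lifting) add.commute add_diff_eq diff_add_cancel scaleR_left.diff scaleR_one scaleR_right_diff_distrib)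
  then show ?thesis by (simp add: collinear_3_expand)
qed

lemma area_neq_0:
  assumes "general_position P" "a \<in> P" "b \<in> P" "c \<in> P" "a \<noteq> b" "a \<noteq> c" "b \<noteq> c"
  shows "area a b c \<noteq> 0"
  using assms collinear_if_area_eq_0 unfolding general_position_def by blast

text \<open>The affine function \<open>area a b\<close> vanishes on the line through
  \<open>a\<close> and \<open>b\<close>, but keeps its sign along the segment from \<open>c\<close>
  to \<open>d\<close>.\<close>

lemma closed_segments_disjoint_if_same_side:
  assumes "area a b c * area a b d > 0"
  shows "closed_segment a b \<inter> closed_segment c d = {}"
proof (rule ccontr)
  assume "closed_segment a b \<inter> closed_segment c d \<noteq> {}"
  then obtain s t where st: "0 \<le> t" "t \<le> 1"
      and eq: "(1 - s) *\<^sub>R a + s *\<^sub>R b = (1 - t) *\<^sub>R c + t *\<^sub>R d"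
    by (auto simp: in_segment) metis
  have "(1 - t) * area a b c + t * area a b d = 0"
    using arg_cong[OF eq, of "area a b"] by (simp add: area_convex_combination)
  moreover have "(1 - t) * area a b c + t * area a b d > 0" if "area a b c > 0" "area a b d > 0"
    using st that by (cases "t = 0") (auto intro!: add_nonneg_pos)
  moreover have "(1 - t) * area a b c + t * area a b d < 0" if "area a b c < 0" "area a b d < 0"
    using st that by (cases "t = 0") (auto intro!: add_nonpos_neg simp: mult_nonneg_nonpos mult_pos_neg)
  ultimately show False
    using assms by (auto simp: zero_less_mult_iff)
qed

text \<open>The two segments leave the line through \<open>v\<close> and \<open>y\<close> towards
  different sides, so a common point would lie on that line. There they have only \<open>y\<close>
  and \<open>v\<close>, which are distinct.\<close>

lemma closed_segments_disjoint_if_opposite_sides: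
  assumes "area v y w * area v y z < 0"
  shows "closed_segment y w \<inter> closed_segment v z = {}"
proof (rule ccontr)
  assume "closed_segment y w \<inter> closed_segment v z \<noteq> {}"
  then obtain s t where st: "0 \<le> t" "t \<le> 1" "0 \<le> s" "s \<le> 1"
      and eq: "(1 - s) *\<^sub>R y + s *\<^sub>R w = (1 - t) *\<^sub>R v + t *\<^sub>R z"
    by (auto simp: in_segment) metis
  have *: "s * area v y w = t * area v y z"
    using arg_cong[OF eq, of "area v y"] by (simp add: area_convex_combination)
  have "s = 0 \<and> t = 0"
  proof (cases "area v y w > 0")
    case True
    then have "area v y z < 0" using assms by (auto simp: mult_less_0_iff)
    then have "s * area v y w \<ge> 0" "t * area v y z \<le> 0"
      using True st by (auto intro!: mult_nonneg_nonpos)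
    then show ?thesis using * True \<open>area v y z < 0\<close> by auto
  next
    case False
    then have "area v y z > 0" "area v y w < 0" using assms by (auto simp: mult_less_0_iff)
    then have "s * area v y w \<le> 0" "t * area v y z \<ge> 0"
      using st by (auto intro!: mult_nonneg_nonpos)
    then show ?thesis using * \<open>area v y z > 0\<close> \<open>area v y w < 0\<close> by auto
  qed
  then have "y = v" using eq by simp
  then show False using assms by simp
qed

lemma closed_segments_meet:
  assumes "area a b c * area a b d < 0" "area c d a * area c d b < 0"
  shows "closed_segment a b \<inter> closed_segment c d \<noteq> {}"
proof -
  \<comment> \<open>Cramer's rule for the two lines: \<open>t\<close> and \<open>s\<close> are the
    parameters of their intersection point on \<open>c d\<close> and \<open>a b\<close>, and the
    sign hypotheses put both into the unit interval.\<close>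
  define D where "D = area a b c - area a b d"
  define t where "t = area a b c / D"
  define s where "s = - area c d a / D"
  have D: "area c d b = area c d a + D" "area a b d = area a b c - D"
    by (simp_all add: D_def area_def algebra_simps)
  have "D \<noteq> 0" using assms by (auto simp: D_def mult_less_0_iff)
  have bounds: "0 \<le> t" "t \<le> 1" "0 \<le> s" "s \<le> 1"
    using assms unfolding t_def s_def D by (auto simp: mult_less_0_iff divide_simps)
  have "(1 - t) * c$i + t * d$i = (1 - s) * a$i + s * b$i" if "i = 1 \<or> i = 2" for i
  proof -
    have "D * ((1 - t) * c$i + t * d$i) = (D - D * t) * c$i + D * t * d$i"
      "D * ((1 - s) * a$i + s * b$i) = (D - D * s) * a$i + D * s * b$i"
      by (simp_all add: algebra_simps)
    moreover have "D * t = area a b c" "D * s = - area c d a"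
      using \<open>D \<noteq> 0\<close> by (simp_all add: t_def s_def)
    moreover have "(D - area a b c) * c$i + area a b c * d$i = (D + area c d a) * a$i - area c d a * b$i"
      using that by (auto simp: D_def area_def algebra_simps)
    ultimately have "D * ((1 - t) * c$i + t * d$i) = D * ((1 - s) * a$i + s * b$i)"
      by simp
    then show ?thesis using \<open>D \<noteq> 0\<close> by simp
  qed
  then have "(1 - t) *\<^sub>R c + t *\<^sub>R d = (1 - s) *\<^sub>R a + s *\<^sub>R b"
    by (auto simp: vec_eq_iff forall_2)
  then have "(1 - t) *\<^sub>R c + t *\<^sub>R d \<in> closed_segment a b" "(1 - t) *\<^sub>R c + t *\<^sub>R d \<in> closed_segment c d"
    using bounds by (auto simp: in_segment)
  then show ?thesis by blast
qed

section \<open>Segments represented by their endpoint pairs\<close>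

definition edges :: "'a set \<Rightarrow> 'a set set" where
  "edges P = {e. e \<subseteq> P \<and> card e = 2}"

definition apart :: "(real^2) set \<Rightarrow> (real^2) set \<Rightarrow> bool" where
  "apart e f \<longleftrightarrow> convex hull e \<inter> convex hull f = {}"

lemma symp_apart: "symp apart"
  by (auto simp: symp_def apart_def)

lemma apart_doubleton: "apart {a, b} {c, d} \<longleftrightarrow> closed_segment a b \<inter> closed_segment c d = {}"
  by (simp add: apart_def segment_convex_hull)

lemma apart_imp_disjoint: "apart e f \<Longrightarrow> e \<inter> f = {}"
  unfolding apart_def using hull_subset[of e convex] hull_subset[of f convex] by blast

lemma mem_edges_iff: "e \<in> edges P \<longleftrightarrow> (\<exists>a b. e = {a, b} \<and> a \<in> P \<and> b \<in> P \<and> a \<noteq> b)"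
  by (auto simp: edges_def card_2_iff)

lemma finite_edges: "finite P \<Longrightarrow> finite (edges P)"
  by (simp add: edges_def)

lemma not_apart_self: "e \<in> edges P \<Longrightarrow> \<not> apart e e"
  by (auto simp: mem_edges_iff apart_doubleton)

text \<open>A segment determines its endpoints, so taking convex hulls is an isomorphism from the
  graph on endpoint pairs to D(P).\<close>

lemma hamiltonian_iff_edges:
  "hamiltonian (edge_disjointness_graph P) \<longleftrightarrow> hamiltonian_on apart (edges P)"
proof -
  have inj: "inj_on (\<lambda>e. convex hull e) (edges P)"
    by (rule inj_onI) (auto simp: mem_edges_iff simp flip: segment_convex_hull)
  have "hamiltonian (edge_disjointness_graph P) \<longleftrightarrow>
      hamiltonian_on (\<lambda>S T. (S, T) \<in> {(S, T). S \<in> segments P \<and> T \<in> segments P \<and> S \<inter> T = {}}) (segments P)"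
    by (simp add: hamiltonian_iff_hamiltonian_on edge_disjointness_graph_def)
  also have "\<dots> \<longleftrightarrow> hamiltonian_on apart (edges P)"
    unfolding segments_eq_image edges_def[symmetric]
  proof
    assume "hamiltonian_on apart (edges P)"
    then show "hamiltonian_on (\<lambda>S T. (S, T) \<in> {(S, T). S \<in> (\<lambda>e. convex hull e) ` edges P \<and>
        T \<in> (\<lambda>e. convex hull e) ` edges P \<and> S \<inter> T = {}}) ((\<lambda>e. convex hull e) ` edges P)"
      using inj by (elim hamiltonian_on_image[rotated 2]) (auto simp: apart_def)
  next
    assume "hamiltonian_on (\<lambda>S T. (S, T) \<in> {(S, T). S \<in> (\<lambda>e. convex hull e) ` edges P \<and>
        T \<in> (\<lambda>e. convex hull e) ` edges P \<and> S \<inter> T = {}}) ((\<lambda>e. convex hull e) ` edges P)"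
    then show "hamiltonian_on apart (edges P)"
      using inj by (elim hamiltonian_on_bij_betw[rotated 2]) (auto simp: apart_def bij_betw_def)
  qed
  finally show ?thesis .
qed

section \<open>Adding a point\<close>

text \<open>Any other edge at \<open>y\<close> ends off the line through \<open>v\<close> and
  \<open>y\<close>, on the side opposite to \<open>x\<close> or to \<open>z\<close>, and therefore
  misses \<open>{v, x}\<close> or \<open>{v, z}\<close>.\<close>

lemma edge_unique_if_separates:
  assumes gp: "general_position P" and E: "E \<subseteq> edges P" "\<And>e f. e \<in> E \<Longrightarrow> f \<in> E \<Longrightarrow> \<not> apart e f"
    and vxz: "{v, x} \<in> E" "{v, y} \<in> E" "{v, z} \<in> E" and sep: "area v y x * area v y z < 0"
    and e: "e \<in> E" "y \<in> e"
  shows "e = {v, y}"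
proof (rule ccontr)
  assume ne: "e \<noteq> {v, y}"
  have "e \<in> edges P" "{v, y} \<in> edges P" using e vxz E by auto
  then obtain w where w: "e = {y, w}" "w \<in> P" "y \<in> P" "w \<noteq> y" "v \<in> P" "v \<noteq> y"
    using e(2) by (auto simp: mem_edges_iff doubleton_eq_iff)
  then have "w \<noteq> v" using ne by auto
  then have "area v y w \<noteq> 0" using w by (intro area_neq_0[OF gp]) auto
  then have "area v y w * area v y x < 0 \<or> area v y w * area v y z < 0"
    using sep by (auto simp: mult_less_0_iff linorder_neq_iff)
  then have "apart e {v, x} \<or> apart e {v, z}"
    by (metis apart_doubleton closed_segments_disjoint_if_opposite_sides w(1))
  then show False using E(2) e vxz by blast
qed

text \<open>With A, B, C for the three areas in the hypotheses, in that order, the products are -AB,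
  AC and BC. If A and B have opposite signs, then C disagrees with one of them.\<close>

lemma exists_separating_line:
  assumes "area v x y \<noteq> 0" "area v y z \<noteq> 0" "area v x z \<noteq> 0"
  shows "area v y x * area v y z < 0 \<or> area v x y * area v x z < 0 \<or> area v z x * area v z y < 0"
  using assms area_swap(2)[of v x y] area_swap(2)[of v y z] area_swap(2)[of v x z]
  by (auto simp: mult_less_0_iff zero_less_mult_iff linorder_neq_iff)

text \<open>If three edges meet at v, the line through one of them separates the other two, so its far
  end meets no further edge. Deleting that end leaves a smaller configuration.\<close>

lemma card_pairwise_meeting_edges_le:
  assumes "finite P" "general_position P" "E \<subseteq> edges P" "\<And>e f. e \<in> E \<Longrightarrow> f \<in> E \<Longrightarrow> \<not> apart e f"
  shows "card E \<le> card P"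
  using assms
proof (induction "card P" arbitrary: P E rule: less_induct)
  case less
  note gp = \<open>general_position P\<close> and E = \<open>E \<subseteq> edges P\<close> and meet = less.prems(4)
  have finE: "finite E" using less.prems finite_edges finite_subset by blast
  show ?case
  proof (cases "\<exists>v\<in>P. card {e \<in> E. v \<in> e} \<le> 1")
    case True
    then obtain v where v: "v \<in> P" "card {e \<in> E. v \<in> e} \<le> 1" by blast
    have "card {e \<in> E. v \<notin> e} \<le> card (P - {v})"
    proof (rule less.hyps)
      show "card (P - {v}) < card P" using v less.prems(1) by (meson card_Diff1_less)
      show "general_position (P - {v})" using gp by (auto simp: general_position_def)
      show "{e \<in> E. v \<notin> e} \<subseteq> edges (P - {v})" using E by (auto simp: edges_def)
    qed (use less.prems meet in auto)
    moreover have "card E = card {e \<in> E. v \<in> e} + card {e \<in> E. v \<notin> e}"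
    proof -
      have "E = {e \<in> E. v \<in> e} \<union> {e \<in> E. v \<notin> e}" by auto
      then have "card E = card ({e \<in> E. v \<in> e} \<union> {e \<in> E. v \<notin> e})" by (rule arg_cong)
      also have "\<dots> = card {e \<in> E. v \<in> e} + card {e \<in> E. v \<notin> e}"
        using finE by (intro card_Un_disjoint) auto
      finally show ?thesis .
    qed
    moreover have "card P = Suc (card (P - {v}))"
      using v less.prems(1) by (metis card_Suc_Diff1)
    ultimately show ?thesis using v by linarith
  next
    case False
    \<comment> \<open>Every point now lies on at least two edges. A point on three edges would give
      rise to another point on at most one.\<close>
    have "card {e \<in> E. v \<in> e} = 2" if v: "v \<in> P" for v
    proof (rule ccontr)
      assume "card {e \<in> E. v \<in> e} \<noteq> 2"
      with False v have "3 \<le> card {e \<in> E. v \<in> e}" by force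
      then obtain T where T: "T \<subseteq> {e \<in> E. v \<in> e}" "card T = 3"
        by (meson obtain_subset_with_card_n)
      then obtain e f g where efg: "e \<in> E" "f \<in> E" "g \<in> E" "v \<in> e" "v \<in> f" "v \<in> g"
          "e \<noteq> f" "f \<noteq> g" "e \<noteq> g"
        by (auto simp: card_3_iff)
      have other: "\<exists>w. e = {v, w} \<and> w \<noteq> v \<and> w \<in> P" if e: "e \<in> E" "v \<in> e" for e
      proof -
        obtain a b where "e = {a, b}" "a \<in> P" "b \<in> P" "a \<noteq> b"
          using e E unfolding subset_iff mem_edges_iff by blast
        then show ?thesis using e(2) by auto
      qed
      from efg obtain x y z where xyz: "{v, x} \<in> E" "{v, y} \<in> E" "{v, z} \<in> E"
          "x \<in> P" "y \<in> P" "z \<in> P" "x \<noteq> v" "y \<noteq> v" "z \<noteq> v" "x \<noteq> y" "y \<noteq> z" "x \<noteq> z"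
      proof -
        obtain x where "e = {v, x}" "x \<noteq> v" "x \<in> P" using other[OF efg(1,4)] by blast
        moreover obtain y where "f = {v, y}" "y \<noteq> v" "y \<in> P" using other[OF efg(2,5)] by blast
        moreover obtain z where "g = {v, z}" "z \<noteq> v" "z \<in> P" using other[OF efg(3,6)] by blast
        ultimately show ?thesis using that[of x y z] efg by auto
      qed
      have "area v x y \<noteq> 0" "area v y z \<noteq> 0" "area v x z \<noteq> 0"
        using area_neq_0[OF gp v] xyz by auto
      from exists_separating_line[OF this] have "\<exists>u\<in>P. \<forall>e\<in>E. u \<in> e \<longrightarrow> e = {v, u}"
      proof (elim disjE)
        assume "area v y x * area v y z < 0"
        from edge_unique_if_separates[OF gp E meet xyz(1,2,3) this] show ?thesis using xyz(5) by auto
      next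
        assume "area v x y * area v x z < 0"
        from edge_unique_if_separates[OF gp E meet xyz(2,1,3) this] show ?thesis using xyz(4) by auto
      next
        assume "area v z x * area v z y < 0"
        from edge_unique_if_separates[OF gp E meet xyz(1,3,2) this] show ?thesis using xyz(6) by auto
      qed
      then obtain u where "u \<in> P" "\<And>e. e \<in> E \<Longrightarrow> u \<in> e \<Longrightarrow> e = {v, u}" by blast
      then have "{e \<in> E. u \<in> e} \<subseteq> {{v, u}}" by auto
      then have "card {e \<in> E. u \<in> e} \<le> 1"
        using card_mono[of "{{v, u}}"] by fastforce
      with False \<open>u \<in> P\<close> show False by blast
    qed
    \<comment> \<open>Double counting of incidences gives as many edges as points.\<close>
    then have "(\<Sum>v\<in>P. card {e \<in> E. v \<in> e}) = 2 * card P" by simp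
    moreover have "(\<Sum>v\<in>P. card {e \<in> E. v \<in> e}) = 2 * card E"
    proof (rule sum_multicount)
      have "{v \<in> P. v \<in> e} = e" if "e \<in> E" for e using that E by (auto simp: edges_def)
      then show "\<forall>e\<in>E. card {v \<in> P. v \<in> e} = 2" using E by (auto simp: edges_def)
    qed (use finE less.prems in auto)
    ultimately show ?thesis by simp
  qed
qed

section \<open>Counting the edges disjoint from a given one\<close>

lemma edges_mono: "A \<subseteq> B \<Longrightarrow> edges A \<subseteq> edges B"
  by (auto simp: edges_def)

lemma card_edges: "finite P \<Longrightarrow> card (edges P) = card P choose 2"
  unfolding edges_def by (rule n_subsets)

text \<open>The right side interpolates between 3 and 4 by the line \<open>3 * a - 6\<close>; the
  difference is half of (a - 3)(a - 4), which is never negative for an integer a. A linear bound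
  lets the counts on two sides of a line be added.\<close>

lemma choose_two_ge: "3 * int a - 6 \<le> int (a choose 2)"
proof -
  have "(int a - 3) * (int a - 4) \<ge> 0"
    by (cases "a \<le> 3") (auto intro: mult_nonpos_nonpos mult_nonneg_nonneg)
  moreover have "2 * int (a choose 2) = int a * (int a - 1)"
  proof -
    have "even (a * (a - 1))" by (cases a) auto
    then have "2 * (a choose 2) = a * (a - 1)" by (simp add: choose_two)
    then show ?thesis by (cases a) (auto simp flip: of_nat_mult simp: algebra_simps)
  qed
  ultimately show ?thesis by (simp add: algebra_simps)
qed

text \<open>The line through \<open>p\<close> and \<open>x\<close> leaves a and b points on its
  sides, with a + b = n - 2 for n the number of points. The edges within a side number at least 3(a
  + b) - 12 = 3n - 18 in total, which is at least n from n = 9 on.\<close>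

lemma card_apart_edge_ge:
  assumes fin: "finite P" and gp: "general_position P" and card: "9 \<le> card P"
    and px: "p \<in> P" "x \<in> P" "p \<noteq> x"
  shows "card P \<le> card {e \<in> edges (P - {p}). apart {p, x} e}"
proof -
  define A where "A = {y \<in> P. area p x y > 0}"
  define B where "B = {y \<in> P. area p x y < 0}"
  have "P = insert p (insert x (A \<union> B))"
    using area_neq_0[OF gp px(1,2) _ px(3)] px by (auto simp: A_def B_def linorder_neq_iff)
  moreover have "p \<notin> A \<union> B" "x \<notin> A \<union> B" by (auto simp: A_def B_def)
  moreover have finAB: "finite A" "finite B" using fin by (auto simp: A_def B_def)
  ultimately have "card P = Suc (Suc (card (A \<union> B)))" using px
    by (metis card_insert_disjoint finite_Un finite_insert insert_iff)
  also have "card (A \<union> B) = card A + card B"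
    using finAB by (intro card_Un_disjoint) (auto simp: A_def B_def)
  finally have cardAB: "card P = Suc (Suc (card A + card B))" .
  have apart: "apart {p, x} e" if "e \<in> edges A \<union> edges B" for e
    using that by (auto simp: mem_edges_iff apart_doubleton A_def B_def mult_neg_neg
        intro!: closed_segments_disjoint_if_same_side)
  have "edges A \<inter> edges B = {}" by (auto simp: mem_edges_iff A_def B_def doubleton_eq_iff)
  then have "card (edges A \<union> edges B) = (card A choose 2) + (card B choose 2)"
    using finAB by (simp add: card_Un_disjoint finite_edges card_edges)
  moreover have "card (edges A \<union> edges B) \<le> card {e \<in> edges (P - {p}). apart {p, x} e}"
  proof (rule card_mono)
    show "finite {e \<in> edges (P - {p}). apart {p, x} e}" using fin by (simp add: finite_edges)
    have "A \<subseteq> P - {p}" "B \<subseteq> P - {p}" by (auto simp: A_def B_def)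
    then show "edges A \<union> edges B \<subseteq> {e \<in> edges (P - {p}). apart {p, x} e}"
      using apart edges_mono by blast
  qed
  ultimately show ?thesis
    using cardAB card choose_two_ge[of "card A"] choose_two_ge[of "card B"] by linarith
qed

lemma hamiltonian_on_edges_insert_point:
  assumes fin: "finite P" and gp: "general_position P" and card: "9 \<le> card P" and p: "p \<in> P"
    and ham: "hamiltonian_on apart (edges (P - {p}))"
  shows "hamiltonian_on apart (edges P)"
proof -
  \<comment> \<open>The edges at \<open>p\<close> are inserted one by one. The degree bound already
    holds with neighbours in \<open>edges (P - {p})\<close> alone, so it is available at every
    stage.\<close>
  have "hamiltonian_on apart (edges (P - {p}) \<union> (\<lambda>x. {p, x}) ` X)" if "X \<subseteq> P - {p}" for X
  proof -
    have "finite X" using that fin finite_subset by blast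
    then show ?thesis using that
    proof (induction X)
      case (insert x X)
      let ?V = "edges (P - {p}) \<union> (\<lambda>x. {p, x}) ` X"
      have V: "insert {p, x} ?V \<subseteq> edges P"
      proof -
        have "{p, y} \<in> edges P" if "y \<in> insert x X" for y
          using that insert.prems p by (auto simp: mem_edges_iff)
        then show ?thesis using edges_mono[of "P - {p}" P] by auto
      qed
      have "finite ?V" using fin insert.hyps by (simp add: finite_edges)
      have "hamiltonian_on apart (insert {p, x} ?V)"
      proof (rule hamiltonian_on_insert[OF symp_apart])
        show "irreflp_on ?V apart" using V not_apart_self by (metis insertCI irreflp_onI subsetD)
        show "{p, x} \<notin> ?V" using insert by (auto simp: mem_edges_iff doubleton_eq_iff)
        show "\<not> apart {p, x} {p, x}" using V not_apart_self by blast
        fix I assume "I \<subseteq> insert {p, x} ?V" "\<And>e f. e \<in> I \<Longrightarrow> f \<in> I \<Longrightarrow> \<not> apart e f"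
        then have "card I \<le> card P"
          using order_trans[OF _ V] by (intro card_pairwise_meeting_edges_le[OF fin gp])
        also have "\<dots> \<le> card {e \<in> edges (P - {p}). apart {p, x} e}"
          using insert.prems p by (intro card_apart_edge_ge[OF fin gp card]) auto
        also have "\<dots> \<le> card {e \<in> ?V. apart {p, x} e}"
          using \<open>finite ?V\<close> by (intro card_mono) auto
        finally show "card I \<le> card {e \<in> ?V. apart {p, x} e}" .
      qed (use insert \<open>finite ?V\<close> in auto)
      then show ?case by simp
    qed (use ham in simp)
  qed
  from this[of "P - {p}"] have "hamiltonian_on apart (edges (P - {p}) \<union> (\<lambda>x. {p, x}) ` (P - {p}))"
    by simp
  also have "edges (P - {p}) \<union> (\<lambda>x. {p, x}) ` (P - {p}) = edges P"
  proof
    show "edges (P - {p}) \<union> (\<lambda>x. {p, x}) ` (P - {p}) \<subseteq> edges P"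
      using p edges_mono[of "P - {p}" P] by (auto simp: edges_def)
    show "edges P \<subseteq> edges (P - {p}) \<union> (\<lambda>x. {p, x}) ` (P - {p})"
    proof
      fix e assume "e \<in> edges P"
      then obtain a b where "e = {a, b}" "a \<in> P" "b \<in> P" "a \<noteq> b"
        unfolding mem_edges_iff by blast
      then show "e \<in> edges (P - {p}) \<union> (\<lambda>x. {p, x}) ` (P - {p})"
        by (cases "a = p"; cases "b = p") (auto simp: edges_def insert_commute)
    qed
  qed
  finally show ?thesis .
qed

section \<open>Sign patterns of six, seven and eight points\<close>

text \<open>Each implication forbids + - + or - + - on three of the four signs, and together they
  leave the sequences with at most one sign change.\<close>

definition at_most_one_change :: "bool \<Rightarrow> bool \<Rightarrow> bool \<Rightarrow> bool \<Rightarrow> bool" where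
  "at_most_one_change a b c d \<longleftrightarrow>
     (a \<and> c \<longrightarrow> b) \<and> (a \<and> d \<longrightarrow> b) \<and> (a \<and> d \<longrightarrow> c) \<and> (b \<and> d \<longrightarrow> c) \<and>
     (b \<longrightarrow> a \<or> c) \<and> (b \<longrightarrow> a \<or> d) \<and> (c \<longrightarrow> a \<or> d) \<and> (c \<longrightarrow> b \<or> d)"

text \<open>Index 0 is reserved for a vertex of the convex hull and the indices from 1 on run around it
  counterclockwise, so only triples of positive indices carry information. The four sign conditions
  are the Grassmann-Pluecker relations with that vertex as fifth point.\<close>

definition signotope :: "nat \<Rightarrow> (nat \<Rightarrow> nat \<Rightarrow> nat \<Rightarrow> bool) \<Rightarrow> bool" where
  "signotope n s \<longleftrightarrow>
     list_all (\<lambda>l. list_all (\<lambda>k. list_all (\<lambda>j. list_all (\<lambda>i.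
       at_most_one_change (s i j k) (s i j l) (s i k l) (s j k l)) [1..<j]) [1..<k]) [1..<l]) [1..<n]"

text \<open>Disjointness of the segments ab and cd, where a < b and a < c < d. Of the three ways to pair up
  four indices, the first never crosses, and for a = 0 the signs involving a are positive.\<close>

definition far :: "(nat \<Rightarrow> nat \<Rightarrow> nat \<Rightarrow> bool) \<Rightarrow> nat \<Rightarrow> nat \<Rightarrow> nat \<Rightarrow> nat \<Rightarrow> bool" where
  "far s a b c d =
     (if b < c then True
      else if b = c then False
      else if b = d then False
      else if a = 0 then (if d < b then True else \<not> s c b d)
      else if d < b then s a c b = s a d b
      else \<not> (s a c b = s a c d \<and> s a c d = s a b d \<and> s a b d = s c b d))"

text \<open>\<open>far\<close> expects the smaller first index in front; equal first indices mean a
  common endpoint.\<close>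

definition index_apart :: "(nat \<Rightarrow> nat \<Rightarrow> nat \<Rightarrow> bool) \<Rightarrow> nat \<times> nat \<Rightarrow> nat \<times> nat \<Rightarrow> bool" where
  "index_apart s e f =
     (if fst e < fst f then far s (fst e) (snd e) (fst f) (snd f)
      else if fst f < fst e then far s (fst f) (snd f) (fst e) (snd e)
      else False)"

text \<open>The failure of a cycle is spelled out in negation normal form, ready for the SAT solver.\<close>

definition crossing :: "(nat \<Rightarrow> nat \<Rightarrow> nat \<Rightarrow> bool) \<Rightarrow> nat \<times> nat \<Rightarrow> nat \<times> nat \<Rightarrow> bool" where
  "crossing s e f \<longleftrightarrow> \<not> index_apart s e f"

lemma crossing_pairs:
  "crossing s (a, b) (c, d) \<longleftrightarrow> (if a < c then \<not> far s a b c d else if c < a then \<not> far s c d a b else True)"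
  by (simp add: crossing_def index_apart_def)

lemma not_far:
  "\<not> far s a b c d \<longleftrightarrow>
     (if b < c then False
      else if b = c then True
      else if b = d then True
      else if a = 0 then (if d < b then False else s c b d)
      else if d < b then s a c b \<and> \<not> s a d b \<or> \<not> s a c b \<and> s a d b
      else s a c b \<and> s a c d \<and> s a b d \<and> s c b d \<or> \<not> s a c b \<and> \<not> s a c d \<and> \<not> s a b d \<and> \<not> s c b d)"
  by (auto simp: far_def)

text \<open>The argument \<open>f\<close> remembers the start of the cycle for the closing link. On
  a concrete list this unfolds to one disjunction over all links; the empty list counts as broken
  because \<open>cyclic\<close> excludes it.\<close>

fun broken :: "(nat \<Rightarrow> nat \<Rightarrow> nat \<Rightarrow> bool) \<Rightarrow> nat \<times> nat \<Rightarrow> (nat \<times> nat) list \<Rightarrow> bool" where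
  "broken s f [] \<longleftrightarrow> True"
| "broken s f [e] \<longleftrightarrow> crossing s e f"
| "broken s f (e # e' # es) \<longleftrightarrow> crossing s e e' \<or> broken s f (e' # es)"

lemma broken_hd:
  assumes "\<not> cyclic (index_apart s) K"
  shows "broken s (hd K) K"
proof -
  have "broken s f K \<or> (K \<noteq> [] \<and> successively (index_apart s) K \<and> index_apart s (last K) f)" for f
    by (induction s f K rule: broken.induct) (auto simp: crossing_def)
  from this[of "hd K"] show ?thesis using assms by (cases K) (auto simp: cyclic_def)
qed

definition pairs :: "nat \<Rightarrow> (nat \<times> nat) list" where
  "pairs n = [(i, j). j \<leftarrow> [0..<n], i \<leftarrow> [0..<j]]"

text \<open>The lists were found by computer search: every signotope (on 6 points, every one with a
  negative sign) admits at least one cycle of the list as a hamiltonian cycle.\<close>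

definition cycles6 :: "(nat \<times> nat) list list" where
  "cycles6 = [
     [(0,3),(1,2),(0,4),(1,3),(0,5),(1,4),(3,5),(0,2),(3,4),(2,5),(0,1),(2,4),(1,5),(2,3),(4,5)],
     [(0,3),(4,5),(1,3),(0,4),(1,5),(2,3),(1,4),(2,5),(0,1),(2,4),(0,5),(3,4),(0,2),(3,5),(1,2)],
     [(1,4),(2,5),(0,3),(1,5),(3,4),(0,2),(3,5),(1,2),(0,4),(1,3),(4,5),(2,3),(0,1),(2,4),(0,5)],
     [(1,4),(0,3),(1,5),(2,4),(1,3),(2,5),(0,1),(3,5),(0,2),(4,5),(2,3),(0,4),(1,2),(3,4),(0,5)],
     [(2,4),(0,1),(2,5),(1,4),(3,5),(0,2),(3,4),(1,2),(0,4),(1,3),(4,5),(0,3),(1,5),(2,3),(0,5)],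
     [(0,3),(1,2),(0,4),(1,3),(2,5),(0,1),(3,5),(0,2),(3,4),(1,5),(2,4),(0,5),(1,4),(2,3),(4,5)],
     [(1,5),(3,4),(2,5),(0,1),(2,4),(0,5),(1,3),(0,4),(2,3),(1,4),(0,3),(4,5),(1,2),(3,5),(0,2)],
     [(0,3),(1,2),(0,4),(1,3),(2,5),(0,1),(3,4),(0,2),(3,5),(1,4),(0,5),(2,4),(1,5),(2,3),(4,5)],
     [(0,3),(1,2),(3,4),(0,5),(1,4),(3,5),(0,2),(1,5),(2,4),(0,1),(2,5),(1,3),(0,4),(2,3),(4,5)],
     [(0,3),(1,2),(3,5),(0,2),(1,5),(3,4),(2,5),(1,4),(0,5),(2,4),(0,1),(2,3),(0,4),(1,3),(4,5)],
     [(0,3),(1,2),(3,5),(0,2),(3,4),(1,5),(2,4),(0,1),(2,5),(1,4),(0,5),(1,3),(0,4),(2,3),(4,5)],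
     [(1,4),(2,3),(0,4),(1,3),(4,5),(0,2),(3,5),(0,1),(2,5),(3,4),(1,5),(2,4),(0,3),(1,2),(0,5)]]"

definition cycles7 :: "(nat \<times> nat) list list" where
  "cycles7 = [
     [(2,6),(1,5),(3,6),(2,5),(0,6),(1,4),(0,5),(2,4),(5,6),(3,4),(0,2),(1,6),(0,3),(4,6),(1,3),
      (0,4),(2,3),(4,5),(1,2),(3,5),(0,1)],
     [(1,5),(0,3),(1,4),(0,5),(2,4),(5,6),(0,4),(1,3),(4,6),(2,3),(4,5),(1,6),(3,4),(0,2),(3,6),
      (1,2),(3,5),(2,6),(0,1),(2,5),(0,6)],
     [(1,6),(0,5),(2,4),(0,6),(2,5),(0,1),(2,6),(1,5),(3,6),(1,4),(5,6),(3,4),(0,2),(3,5),(1,2),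
      (0,4),(1,3),(4,5),(0,3),(4,6),(2,3)],
     [(1,5),(2,3),(0,4),(1,3),(4,6),(0,3),(4,5),(2,6),(0,1),(2,5),(1,6),(2,4),(0,5),(1,4),(5,6),
      (3,4),(0,2),(3,6),(1,2),(3,5),(0,6)],
     [(1,5),(0,4),(2,5),(1,6),(3,5),(0,2),(3,6),(1,2),(0,3),(4,6),(1,3),(4,5),(2,3),(0,5),(3,4),
      (0,1),(2,6),(1,4),(5,6),(2,4),(0,6)],
     [(1,5),(2,6),(3,4),(1,6),(3,5),(0,2),(3,6),(1,2),(0,4),(1,3),(4,6),(0,3),(4,5),(2,3),(0,5),
      (1,4),(5,6),(2,4),(0,1),(2,5),(0,6)],
     [(1,5),(0,6),(2,5),(0,1),(2,6),(0,3),(4,6),(2,3),(4,5),(1,3),(0,4),(5,6),(1,4),(0,5),(3,4),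
      (0,2),(3,6),(1,2),(3,5),(1,6),(2,4)],
     [(2,6),(4,5),(1,6),(2,4),(0,5),(1,4),(0,6),(1,5),(3,6),(2,5),(1,3),(0,4),(2,3),(4,6),(0,3),
      (1,2),(3,5),(0,2),(3,4),(5,6),(0,1)],
     [(2,5),(0,1),(2,6),(0,5),(1,4),(5,6),(2,4),(1,6),(2,3),(0,4),(1,3),(4,5),(0,3),(4,6),(0,2),
      (3,5),(1,2),(3,6),(1,5),(3,4),(0,6)],
     [(2,5),(0,1),(3,6),(0,2),(3,5),(1,2),(0,3),(4,6),(1,5),(2,6),(1,3),(4,5),(2,3),(0,4),(1,6),
      (2,4),(5,6),(3,4),(0,5),(1,4),(0,6)],
     [(1,6),(2,5),(3,6),(1,5),(0,6),(1,4),(0,5),(2,4),(5,6),(3,4),(0,2),(3,5),(1,2),(0,4),(1,3),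
      (4,5),(2,3),(4,6),(0,1),(2,6),(0,3)],
     [(1,5),(4,6),(0,3),(4,5),(1,3),(0,4),(2,3),(5,6),(2,4),(0,1),(2,6),(1,4),(2,5),(1,6),(0,2),
      (3,6),(0,5),(3,4),(1,2),(3,5),(0,6)],
     [(2,5),(1,3),(0,4),(5,6),(2,4),(0,5),(1,4),(2,6),(3,4),(0,6),(3,5),(1,2),(3,6),(0,2),(1,5),
      (0,3),(4,6),(2,3),(1,6),(4,5),(0,1)],
     [(1,5),(2,4),(1,6),(2,5),(1,4),(2,6),(0,1),(3,6),(0,2),(3,5),(0,4),(1,3),(0,5),(3,4),(5,6),
      (2,3),(4,6),(0,3),(1,2),(4,5),(0,6)]]"

definition cycles8 :: "(nat \<times> nat) list list" where
  "cycles8 = [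
     [(2,6),(0,7),(1,5),(0,6),(1,7),(0,5),(1,4),(2,7),(1,6),(3,7),(4,5),(1,3),(4,7),(0,3),(4,6),
      (2,3),(0,4),(5,7),(2,4),(5,6),(3,4),(1,2),(3,6),(0,2),(3,5),(6,7),(2,5),(0,1)],
     [(2,6),(0,1),(2,7),(1,6),(2,5),(0,6),(1,5),(6,7),(3,5),(0,2),(3,7),(1,2),(3,6),(1,7),(4,6),
      (0,3),(4,7),(1,3),(4,5),(2,3),(0,4),(5,7),(2,4),(0,5),(3,4),(5,6),(1,4),(0,7)],
     [(2,7),(0,6),(1,7),(0,5),(1,4),(5,7),(2,4),(5,6),(0,4),(1,3),(4,6),(0,3),(4,5),(2,3),(4,7),
      (2,6),(0,7),(1,5),(6,7),(2,5),(3,4),(1,6),(3,7),(0,2),(3,5),(1,2),(3,6),(0,1)],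
     [(1,6),(2,4),(3,7),(0,2),(3,6),(0,1),(2,7),(4,6),(0,3),(4,7),(2,3),(0,4),(5,7),(1,4),(0,5),
      (3,4),(5,6),(1,3),(4,5),(1,2),(3,5),(6,7),(1,5),(0,6),(2,5),(1,7),(2,6),(0,7)],
     [(2,7),(1,5),(2,6),(1,7),(3,6),(0,7),(1,6),(0,2),(3,7),(1,2),(3,5),(0,6),(2,5),(6,7),(1,4),
      (0,5),(2,4),(5,6),(3,4),(5,7),(0,4),(1,3),(4,6),(0,3),(4,7),(2,3),(4,5),(0,1)],
     [(1,6),(0,5),(2,7),(1,5),(2,6),(3,5),(1,7),(0,3),(4,7),(0,2),(3,7),(1,2),(3,6),(0,1),(2,5),
      (0,6),(2,4),(5,7),(3,4),(5,6),(1,4),(6,7),(0,4),(1,3),(4,5),(2,3),(4,6),(0,7)],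
     [(1,6),(2,5),(1,7),(2,6),(1,4),(0,5),(2,4),(0,6),(1,5),(6,7),(3,5),(0,2),(3,7),(0,1),(2,7),
      (5,6),(3,4),(5,7),(0,4),(2,3),(4,7),(0,3),(4,6),(1,3),(4,5),(1,2),(3,6),(0,7)],
     [(1,7),(0,4),(2,7),(0,1),(2,6),(0,7),(1,6),(5,7),(2,4),(0,5),(3,4),(5,6),(1,4),(3,7),(0,2),
      (3,6),(1,2),(0,3),(4,5),(1,3),(4,6),(2,3),(6,7),(2,5),(4,7),(1,5),(0,6),(3,5)],
     [(1,6),(4,5),(1,7),(3,5),(2,7),(3,4),(2,6),(0,1),(3,7),(0,2),(3,6),(1,2),(4,7),(0,3),(4,6),
      (2,3),(0,4),(5,7),(1,3),(0,5),(1,4),(5,6),(2,4),(6,7),(2,5),(0,6),(1,5),(0,7)],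
     [(1,7),(2,4),(0,5),(1,4),(5,6),(0,4),(1,3),(4,6),(0,3),(2,7),(3,6),(2,5),(6,7),(1,5),(0,7),
      (2,6),(0,1),(3,7),(0,2),(3,5),(1,2),(3,4),(5,7),(1,6),(4,7),(2,3),(4,5),(0,6)],
     [(1,7),(0,2),(3,6),(1,5),(2,7),(1,6),(3,7),(0,1),(2,6),(0,7),(2,5),(0,6),(3,5),(6,7),(2,4),
      (0,5),(1,4),(5,7),(3,4),(1,2),(4,5),(0,3),(4,7),(1,3),(4,6),(2,3),(0,4),(5,6)],
     [(2,6),(0,7),(3,6),(0,2),(1,7),(0,3),(4,6),(1,3),(4,7),(2,3),(0,4),(5,6),(1,4),(0,5),(2,4),
      (5,7),(3,4),(1,2),(4,5),(0,6),(3,5),(6,7),(1,5),(3,7),(2,5),(1,6),(2,7),(0,1)],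
     [(2,6),(0,1),(2,7),(3,6),(2,5),(0,6),(1,5),(6,7),(3,5),(0,2),(3,7),(1,2),(3,4),(0,5),(1,7),
      (0,4),(1,6),(4,7),(0,3),(4,5),(1,3),(4,6),(2,3),(5,7),(1,4),(5,6),(2,4),(0,7)],
     [(1,6),(4,7),(2,6),(1,7),(2,5),(0,6),(1,5),(6,7),(3,5),(0,2),(3,7),(0,1),(2,7),(1,3),(4,5),
      (0,3),(4,6),(2,3),(0,4),(5,7),(2,4),(0,5),(1,4),(5,6),(3,4),(1,2),(3,6),(0,7)],
     [(1,6),(0,5),(2,7),(1,5),(2,6),(0,1),(3,7),(0,2),(3,6),(1,2),(3,5),(0,6),(2,5),(6,7),(1,4),
      (5,7),(3,4),(1,7),(2,4),(5,6),(0,4),(1,3),(4,7),(0,3),(4,5),(2,3),(4,6),(0,7)],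
     [(2,6),(0,1),(3,6),(0,2),(1,7),(0,3),(4,7),(1,3),(4,6),(2,7),(1,4),(5,6),(0,4),(5,7),(2,4),
      (0,5),(3,4),(1,2),(3,7),(1,6),(2,5),(0,6),(3,5),(6,7),(1,5),(2,3),(4,5),(0,7)],
     [(2,6),(0,7),(3,6),(0,2),(3,7),(1,2),(3,5),(1,6),(2,5),(0,6),(1,4),(0,5),(3,4),(1,7),(2,4),
      (5,6),(0,4),(5,7),(0,3),(4,6),(1,3),(4,7),(2,3),(4,5),(6,7),(1,5),(2,7),(0,1)],
     [(1,6),(0,2),(1,7),(3,5),(2,7),(1,3),(4,7),(0,3),(4,6),(2,3),(4,5),(0,6),(2,5),(6,7),(1,5),
      (0,4),(5,7),(1,4),(0,5),(3,4),(5,6),(2,4),(3,6),(1,2),(3,7),(0,1),(2,6),(0,7)],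
     [(1,6),(3,7),(2,6),(5,7),(0,4),(1,3),(4,6),(0,3),(4,7),(0,2),(3,6),(1,2),(4,5),(2,3),(0,5),
      (3,4),(5,6),(0,1),(2,7),(1,4),(3,5),(2,4),(1,7),(0,6),(2,5),(6,7),(1,5),(0,7)],
     [(1,6),(5,7),(0,4),(1,3),(4,7),(0,3),(4,6),(0,2),(3,7),(1,4),(3,6),(1,7),(0,5),(2,7),(0,1),
      (2,6),(1,5),(2,3),(4,5),(6,7),(2,5),(0,6),(2,4),(5,6),(3,4),(1,2),(3,5),(0,7)],
     [(1,6),(5,7),(2,6),(1,5),(0,6),(1,4),(0,5),(2,4),(1,7),(2,5),(6,7),(3,5),(0,2),(3,7),(0,1),
      (2,7),(5,6),(3,4),(1,2),(3,6),(4,7),(0,3),(4,6),(2,3),(0,4),(1,3),(4,5),(0,7)],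
     [(1,6),(2,3),(4,7),(0,3),(4,6),(0,2),(3,7),(1,2),(3,6),(1,5),(2,6),(1,7),(4,5),(0,6),(3,5),
      (0,1),(2,7),(1,3),(2,5),(6,7),(0,4),(5,7),(3,4),(0,5),(1,4),(5,6),(2,4),(0,7)],
     [(1,6),(3,7),(2,5),(1,7),(2,6),(1,5),(0,6),(3,5),(0,2),(3,6),(2,4),(0,5),(1,4),(2,7),(0,1),
      (4,7),(0,3),(4,6),(1,3),(5,7),(3,4),(5,6),(0,4),(6,7),(1,2),(4,5),(2,3),(0,7)],
     [(1,6),(0,7),(2,6),(1,7),(2,5),(3,6),(2,7),(4,5),(0,3),(4,7),(1,3),(0,4),(5,7),(1,4),(0,5),
      (2,4),(0,6),(1,5),(4,6),(3,5),(1,2),(3,7),(0,2),(5,6),(3,4),(0,1),(6,7),(2,3)]]"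

text \<open>The part of being a hamiltonian cycle that does not depend on the signs, checked by
  evaluation.\<close>

lemma cycles_span:
  "list_all (\<lambda>K. distinct K \<and> length K = length (pairs 6) \<and> list_all (\<lambda>e. e \<in> set K) (pairs 6)) cycles6"
  "list_all (\<lambda>K. distinct K \<and> length K = length (pairs 7) \<and> list_all (\<lambda>e. e \<in> set K) (pairs 7)) cycles7"
  "list_all (\<lambda>K. distinct K \<and> length K = length (pairs 8) \<and> list_all (\<lambda>e. e \<in> set K) (pairs 8)) cycles8"
  by code_simp+

lemma all_broken_if_not_hamiltonian:
  assumes "list_all (\<lambda>K. distinct K \<and> length K = length (pairs n) \<and> list_all (\<lambda>e. e \<in> set K) (pairs n)) Ks"
    "3 \<le> length (pairs n)" "\<not> hamiltonian_on (index_apart s) (set (pairs n))"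
  shows "list_all (\<lambda>K. broken s (hd K) K) Ks"
  unfolding list_all_iff
proof (intro ballI broken_hd notI)
  fix K assume K: "K \<in> set Ks" "cyclic (index_apart s) K"
  then have *: "distinct K" "length K = length (pairs n)" "set (pairs n) \<subseteq> set K"
    using assms(1) by (auto simp: list_all_iff)
  have "card (set K) \<le> card (set (pairs n))" if "distinct (pairs n)"
    using * that by (simp add: distinct_card)
  moreover have "distinct (pairs n)"
  proof -
    \<comment> \<open>The blocks that make up \<open>pairs n\<close> have different lengths and are
      therefore different lists.\<close>
    have "inj_on (\<lambda>j. map (\<lambda>i. (i, j)) [0..<j]) A" for A :: "nat set"
      by (rule inj_onI, drule arg_cong[of _ _ length]) simp
    then have "distinct (map (\<lambda>j. map (\<lambda>i. (i, j)) [0..<j]) [0..<n])"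
      by (simp add: distinct_map)
    then show ?thesis
      unfolding pairs_def by (rule distinct_concat) (auto simp: distinct_map inj_on_def)
  qed
  ultimately have "set K = set (pairs n)" using *(3) by (intro card_seteq[symmetric]) auto
  then have "hamiltonian_on (index_apart s) (set (pairs n))"
    using assms(2) K(2) * unfolding hamiltonian_on_def by (intro exI[of _ K]) auto
  then show False using assms(3) by blast
qed

text \<open>These rules compute all comparisons of indices and leave a propositional formula whose
  atoms are the signs \<open>s i j k\<close>.\<close>

lemmas signotope_evaluation =
  signotope_def at_most_one_change_def broken.simps crossing_pairs not_far
  list.sel list.pred_inject list_all_append upt.simps eval_nat_numeral BitM.simps numeral_One One_nat_def
  le0 Suc_le_mono le_zero_eq append.simps zero_less_Suc less_nat_zero_code Suc_less_eq nat.inject nat.distinct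
  if_True if_False simp_thms

text \<open>Otherwise every listed cycle has a broken link. Together with the signotope conditions
  and one negative sign, this is propositionally contradictory in the 10 signs of triples from 1 to
  5. Seven and eight points are treated alike, with 20 and 35 signs.\<close>

lemma hamiltonian_on_pairs_6:
  assumes s: "signotope 6 s" and ncv: "\<not> list_all (\<lambda>k. list_all (\<lambda>j. list_all (\<lambda>i. s i j k) [1..<j]) [1..<k]) [1..<6]"
  shows "hamiltonian_on (index_apart s) (set (pairs 6))"
proof (rule ccontr)
  assume nh: "\<not> ?thesis"
  have "list_all (\<lambda>K. broken s (hd K) K) cycles6"
    by (rule all_broken_if_not_hamiltonian[OF cycles_span(1) _ nh]) code_simp
  then show False
    using s ncv
    by (simp (no_asm_use) only: cycles6_def signotope_evaluation) satx
qed

lemma hamiltonian_on_pairs_7: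
  assumes s: "signotope 7 s"
  shows "hamiltonian_on (index_apart s) (set (pairs 7))"
proof (rule ccontr)
  assume nh: "\<not> ?thesis"
  have "list_all (\<lambda>K. broken s (hd K) K) cycles7"
    by (rule all_broken_if_not_hamiltonian[OF cycles_span(2) _ nh]) code_simp
  then show False
    using s
    by (simp (no_asm_use) only: cycles7_def signotope_evaluation) satx
qed

lemma hamiltonian_on_pairs_8:
  assumes s: "signotope 8 s"
  shows "hamiltonian_on (index_apart s) (set (pairs 8))"
proof (rule ccontr)
  assume nh: "\<not> ?thesis"
  have "list_all (\<lambda>K. broken s (hd K) K) cycles8"
    by (rule all_broken_if_not_hamiltonian[OF cycles_span(3) _ nh]) code_simp
  then show False
    using s
    by (simp (no_asm_use) only: cycles8_def signotope_evaluation) satx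
qed

section \<open>Exhaustive search\<close>

text \<open>Depth-first search for a closed path: \<open>r\<close> is the start to return to,
  \<open>k\<close> the number of steps left, \<open>v\<close> the current end, \<open>us\<close> the
  unvisited vertices and \<open>cs\<close> those of them still to be tried as the next one.\<close>

fun search :: "('a \<Rightarrow> 'a \<Rightarrow> bool) \<Rightarrow> 'a \<Rightarrow> nat \<Rightarrow> 'a \<Rightarrow> 'a list \<Rightarrow> 'a list \<Rightarrow> bool" where
  "search R r 0 v us cs \<longleftrightarrow> R v r"
| "search R r (Suc k) v us [] \<longleftrightarrow> False"
| "search R r (Suc k) v us (c # cs) \<longleftrightarrow>
    (if R v c
     then if search R r k c (remove1 c us) (remove1 c us) then True else search R r (Suc k) v us cs
     else search R r (Suc k) v us cs)"

lemma search_step: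
  "c \<in> set cs \<Longrightarrow> R v c \<Longrightarrow> search R r k c (remove1 c us) (remove1 c us) \<Longrightarrow> search R r (Suc k) v us cs"
  by (induction cs) auto

text \<open>The path guides the search: its next vertex is among the candidates and is then removed.
  Equality of multisets makes the order of \<open>us\<close> irrelevant.\<close>

lemma search_complete:
  assumes "successively R (v # xs)" "R (last (v # xs)) r" "mset xs = mset us"
  shows "search R r (length us) v us us"
  using assms
proof (induction xs arbitrary: v us)
  case (Cons x xs)
  have "x \<in> set us" using mset_eq_setD[OF Cons.prems(3)] by auto
  have "mset xs = mset (remove1 x us)"
    using arg_cong[OF Cons.prems(3), of "\<lambda>M. M - {#x#}"] by simp
  moreover have "successively R (x # xs)" "R (last (x # xs)) r" "R v x"
    using Cons.prems(1,2) by simp_all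
  ultimately have "search R r (length (remove1 x us)) x (remove1 x us) (remove1 x us)"
    by (intro Cons.IH)
  then have "search R r (Suc (length (remove1 x us))) v us us"
    by (rule search_step[of x us R v, OF \<open>x \<in> set us\<close> \<open>R v x\<close>])
  moreover have "length us = Suc (length (remove1 x us))"
    using mset_eq_length[OF Cons.prems(3)] mset_eq_length[OF \<open>mset xs = mset (remove1 x us)\<close>] by simp
  ultimately show ?case by simp
qed simp

definition search_from_hd :: "('a \<Rightarrow> 'a \<Rightarrow> bool) \<Rightarrow> 'a list \<Rightarrow> bool" where
  "search_from_hd R xs = search R (hd xs) (length (tl xs)) (hd xs) (tl xs) (tl xs)"

text \<open>A hamiltonian cycle can be rotated to start at any vertex, so searching from the first
  one is enough.\<close>

lemma not_hamiltonian_on_if_search_fails: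
  assumes "distinct xs \<and> xs \<noteq> [] \<and> \<not> search_from_hd R xs"
  shows "\<not> hamiltonian_on R (set xs)"
proof
  assume "hamiltonian_on R (set xs)"
  then obtain ys where ys: "distinct ys" "set ys = set xs" "cyclic R ys"
    by (auto simp: hamiltonian_on_def)
  obtain v us where xs: "xs = v # us" using assms by (cases xs) auto
  then have "v \<in> set ys" using ys by auto
  then obtain as bs where eq: "ys = as @ v # bs" by (meson split_list)
  have "cyclic R (v # bs @ as)"
    using ys(3) cyclic_append_commute[of R as "v # bs"] eq by simp
  moreover have "set (bs @ as) = set us"
    using ys(1,2) assms eq xs by auto
  then have "mset (bs @ as) = mset us"
    using ys(1) assms eq xs by (subst set_eq_iff_mset_eq_distinct[symmetric]) auto
  ultimately show False
    using search_complete[of R v "bs @ as" v us] assms by (simp add: cyclic_def search_from_hd_def xs)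
qed

text \<open>Adjacency in the Kneser graph of two-element sets. Disjoint segments share no endpoint,
  so D(P) is a subgraph of it.\<close>

definition no_common_index :: "nat \<times> nat \<Rightarrow> nat \<times> nat \<Rightarrow> bool" where
  "no_common_index e f \<longleftrightarrow> fst e \<noteq> fst f \<and> fst e \<noteq> snd f \<and> snd e \<noteq> fst f \<and> snd e \<noteq> snd f"

lemma not_hamiltonian_on_kneser:
  assumes "n \<in> {2, 3, 4, 5}"
  shows "\<not> hamiltonian_on no_common_index (set (pairs n))"
proof (rule not_hamiltonian_on_if_search_fails)
  have "list_all (\<lambda>n. distinct (pairs n) \<and> pairs n \<noteq> [] \<and> \<not> search_from_hd no_common_index (pairs n)) [2, 3, 4, 5]"
    by code_simp
  then show "distinct (pairs n) \<and> pairs n \<noteq> [] \<and> \<not> search_from_hd no_common_index (pairs n)"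
    using assms by (auto simp only: list_all_iff list.set insert_iff empty_iff)
qed

text \<open>Constantly positive signs describe a convex hexagon with its corners numbered
  counterclockwise.\<close>

lemma not_hamiltonian_on_hexagon: "\<not> hamiltonian_on (index_apart (\<lambda>_ _ _. True)) (set (pairs 6))"
  by (rule not_hamiltonian_on_if_search_fails) code_simp

section \<open>Labelling the points\<close>

text \<open>Insertion sort for a relation that is total and transitive only on the given set, as the
  angular order around a point is.\<close>

lemma exists_sorted_wrt:
  assumes "finite A" "totalp_on A R" "transp_on A R"
  shows "\<exists>xs. set xs = A \<and> distinct xs \<and> sorted_wrt R xs"
  using assms
proof (induction A rule: finite_induct)
  case (insert x A)
  note total = \<open>totalp_on (insert x A) R\<close> and trans = \<open>transp_on (insert x A) R\<close>
  have "totalp_on A R" "transp_on A R"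
    using total trans by (auto intro: totalp_on_subset transp_on_subset)
  then obtain xs where xs: "set xs = A" "distinct xs" "sorted_wrt R xs"
    using insert.IH by blast
  let ?ys = "filter (\<lambda>y. R y x) xs @ x # filter (\<lambda>y. \<not> R y x) xs"
  have after: "R x z" if "z \<in> A" "\<not> R z x" for z
    using totalp_onD[OF total, of x z] insert.hyps(2) that by auto
  have across: "R y z" if "y \<in> A" "z \<in> A" "R y x" "\<not> R z x" for y z
    using transp_onD[OF trans, of y x z] after[of z] that by simp
  have "sorted_wrt R (filter Q xs)" for Q using xs(3) by (rule sorted_wrt_filter)
  then have "sorted_wrt R ?ys"
    using xs(1) after across by (simp add: sorted_wrt_append)
  moreover have "set ?ys = insert x A" using xs(1) by auto
  moreover have "distinct ?ys" using xs insert.hyps(2) by auto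
  ultimately show ?case by blast
qed simp

lemma set_pairs: "set (pairs n) = {(i, j). i < j \<and> j < n}"
  by (auto simp: pairs_def)

lemma bij_betw_pairs_edges:
  assumes "bij_betw p {..<n} P"
  shows "bij_betw (\<lambda>(i, j). {p i, p j}) (set (pairs n)) (edges P)"
proof -
  have inj: "p i = p j \<longleftrightarrow> i = j" if "i < n" "j < n" for i j
    using assms that by (auto simp: bij_betw_def inj_on_def)
  have P: "P = p ` {..<n}" using assms by (simp add: bij_betw_def)
  have "inj_on (\<lambda>(i, j). {p i, p j}) (set (pairs n))"
    by (auto simp: inj_on_def set_pairs doubleton_eq_iff inj)
  moreover have "(\<lambda>(i, j). {p i, p j}) ` set (pairs n) = edges P"
  proof
    show "(\<lambda>(i, j). {p i, p j}) ` set (pairs n) \<subseteq> edges P"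
      by (fastforce simp: set_pairs mem_edges_iff P inj)
    show "edges P \<subseteq> (\<lambda>(i, j). {p i, p j}) ` set (pairs n)"
    proof
      fix e assume "e \<in> edges P"
      then obtain i j where ij: "e = {p i, p j}" "i < n" "j < n" "i \<noteq> j"
        by (auto simp: mem_edges_iff P)
      then have "e = (\<lambda>(i, j). {p i, p j}) (min i j, max i j)" "(min i j, max i j) \<in> set (pairs n)"
        by (auto simp: set_pairs min_def max_def)
      then show "e \<in> (\<lambda>(i, j). {p i, p j}) ` set (pairs n)" by (rule image_eqI)
    qed
  qed
  ultimately show ?thesis by (simp add: bij_betw_def)
qed

text \<open>Points lexicographically after \<open>q\<close> are seen from \<open>q\<close> within a
  half-open half-turn of directions, where the counterclockwise order is transitive. The direction
  straight up is the last one.\<close>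

lemma area_pos_trans:
  fixes q x y z :: "real^2"
  defines "later \<equiv> \<lambda>v. q$1 < v$1 \<or> q$1 = v$1 \<and> q$2 < v$2"
  assumes "later x" "later y" "later z" "area q x y > 0" "area q y z > 0"
  shows "area q x z > 0"
proof (cases "q$1 < y$1")
  case True
  have eq: "area q x z * (y$1 - q$1) = area q x y * (z$1 - q$1) + area q y z * (x$1 - q$1)"
    by (simp add: area_def algebra_simps)
  have "q$1 < x$1"
  proof (rule ccontr)
    assume "\<not> q$1 < x$1"
    then have "x$1 = q$1" "q$2 < x$2" using assms(2) by (auto simp: later_def)
    then have "area q x y = - ((x$2 - q$2) * (y$1 - q$1))" by (simp add: area_def)
    then show False using True \<open>q$2 < x$2\<close> assms(5) by (simp add: mult_less_0_iff)
  qed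
  moreover have "q$1 \<le> z$1" using assms(4) by (auto simp: later_def)
  ultimately have "area q x z * (y$1 - q$1) > 0"
    unfolding eq using assms(5,6) by (intro add_nonneg_pos) auto
  then show ?thesis using True by (simp add: zero_less_mult_iff)
next
  case False
  then have "y$1 = q$1" "q$2 < y$2" using assms(3) by (auto simp: later_def)
  then have "area q y z = - ((y$2 - q$2) * (z$1 - q$1))" by (simp add: area_def)
  then show ?thesis
    using assms(4,6) \<open>q$2 < y$2\<close> by (auto simp: later_def mult_less_0_iff)
qed

section \<open>Angular order around a hull vertex and the resulting signs\<close>

definition radial_enumeration :: "(nat \<Rightarrow> real^2) \<Rightarrow> nat \<Rightarrow> (real^2) set \<Rightarrow> bool" where
  "radial_enumeration p n P \<longleftrightarrow> bij_betw p {..<n} P \<and>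
     (\<forall>i j. 0 < i \<longrightarrow> i < j \<longrightarrow> j < n \<longrightarrow> area (p 0) (p i) (p j) > 0)"

lemma exists_radial_enumeration:
  assumes fin: "finite P" and gp: "general_position P" and card: "card P = n" "0 < n"
  shows "\<exists>p. radial_enumeration p n P"
proof -
  let ?L = "\<lambda>x y :: real^2. x$1 < y$1 \<or> x$1 = y$1 \<and> x$2 < y$2"
  have "\<exists>xs. set xs = P \<and> distinct xs \<and> sorted_wrt ?L xs"
    \<comment> \<open>The lexicographically least point becomes the hull vertex \<open>q\<close>,
      around which the others are sorted by angle.\<close>
    using fin by (rule exists_sorted_wrt) (auto simp: totalp_on_def transp_on_def vec_eq_iff forall_2)
  then obtain xs where xs: "set xs = P" "distinct xs" "sorted_wrt ?L xs" by blast
  then obtain q ys where q: "xs = q # ys" using card by (cases xs) auto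
  have later: "?L q y" if "y \<in> set ys" for y using that xs(3) q by auto
  have qys: "q \<in> P" "set ys \<subseteq> P" "q \<notin> set ys" using xs q by auto
  have "\<exists>zs. set zs = set ys \<and> distinct zs \<and> sorted_wrt (\<lambda>x y. area q x y > 0) zs"
  proof (rule exists_sorted_wrt)
    show "totalp_on (set ys) (\<lambda>x y. area q x y > 0)"
    proof (rule totalp_onI)
      fix x y assume "x \<in> set ys" "y \<in> set ys" "x \<noteq> y"
      then have "area q x y \<noteq> 0" using qys by (intro area_neq_0[OF gp]) auto
      then show "area q x y > 0 \<or> area q y x > 0" using area_swap(2)[of q x y] by auto
    qed
    show "transp_on (set ys) (\<lambda>x y. area q x y > 0)"
      using later area_pos_trans by (intro transp_onI) blast
  qed simp
  then obtain zs where zs: "set zs = set ys" "distinct zs" "sorted_wrt (\<lambda>x y. area q x y > 0) zs" by blast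
  let ?p = "\<lambda>i. (q # zs) ! i"
  have P: "set (q # zs) = P" "distinct (q # zs)" using zs xs q by auto
  then have len: "length (q # zs) = n" using card distinct_card by metis
  have "bij_betw ?p {..<n} P" using P len by (intro bij_betw_nth) auto
  moreover have "area (?p 0) (?p i) (?p j) > 0" if "0 < i" "i < j" "j < n" for i j
    using that zs(3) len by (auto simp: sorted_wrt_iff_nth_less nth_Cons split: nat.splits)
  ultimately show ?thesis unfolding radial_enumeration_def by (intro exI[of _ ?p]) auto
qed

text \<open>Turns a three-term relation with positive coefficients into two clauses of
  \<open>at_most_one_change\<close>.\<close>

lemma sign_between:
  fixes u :: real
  assumes "u * x + v * y = w * z" "u > 0" "v > 0" "w > 0"
  shows "x > 0 \<Longrightarrow> y > 0 \<Longrightarrow> z > 0" "z > 0 \<Longrightarrow> x > 0 \<or> y > 0"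
proof -
  show "z > 0" if "x > 0" "y > 0"
  proof -
    have "w * z > 0" using that assms by (metis add_pos_pos mult_pos_pos)
    then show ?thesis using assms(4) by (simp add: zero_less_mult_iff)
  qed
  show "x > 0 \<or> y > 0" if "z > 0"
  proof (rule ccontr)
    assume "\<not> ?thesis"
    then have "u * x + v * y \<le> 0" using assms by (intro add_nonpos_nonpos) (auto simp: mult_le_0_iff)
    then show False using that assms by (simp add: mult_le_0_iff)
  qed
qed

lemma signotope_radial_enumeration:
  assumes "radial_enumeration p n P"
  shows "signotope n (\<lambda>i j k. area (p i) (p j) (p k) > 0)"
proof -
  have pos: "area (p 0) (p i) (p j) > 0" if "0 < i" "i < j" "j < n" for i j
    using assms that by (auto simp: radial_enumeration_def)
  have "at_most_one_change (area a b c > 0) (area a b d > 0) (area a c d > 0) (area b c d > 0)"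
    if "area q a b > 0" "area q a c > 0" "area q a d > 0" "area q b c > 0" "area q b d > 0" "area q c d > 0"
    for q a b c d
  proof -
    \<comment> \<open>Grassmann-Pluecker relations with fifth point \<open>q\<close>. Each one
      concerns three of the four signs and yields the two clauses about them.\<close>
    have 1: "area q a b * area a c d + area q a d * area a b c = area q a c * area a b d"
      and 2: "area q a b * area b c d + area q b d * area a b c = area q b c * area a b d"
      and 3: "area q a c * area b c d + area q c d * area a b c = area q b c * area a c d"
      and 4: "area q a d * area b c d + area q c d * area a b d = area q b d * area a c d"
      by (simp_all add: area_def algebra_simps)
    show ?thesis
      unfolding at_most_one_change_def
      using sign_between[OF 1] sign_between[OF 2] sign_between[OF 3] sign_between[OF 4] that by blast
  qed
  note change = this[of "p 0"]
  show ?thesis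
    unfolding signotope_def list_all_iff set_upt by (intro ballI change pos) auto
qed

section \<open>From signs to disjoint segments\<close>

lemma closed_segments_disjoint_if_sign_eq:
  assumes "(area a b c > 0) = (area a b d > 0)" "area a b c \<noteq> 0" "area a b d \<noteq> 0"
  shows "closed_segment a b \<inter> closed_segment c d = {}"
  using assms by (intro closed_segments_disjoint_if_same_side) (auto simp: zero_less_mult_iff linorder_neq_iff)

text \<open>It suffices that one of the two lines leaves both ends of the other segment on one side.
  In each relative order of the indices, \<open>far\<close> and the signotope condition provide such
  a line.\<close>

lemma far_imp_disjoint:
  assumes gp: "general_position P" and p: "radial_enumeration p n P"
    and idx: "a < b" "b < n" "c < d" "d < n" "a < c"
    and far: "far (\<lambda>i j k. area (p i) (p j) (p k) > 0) a b c d"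
  shows "closed_segment (p a) (p b) \<inter> closed_segment (p c) (p d) = {}"
proof -
  let ?s = "\<lambda>i j k. area (p i) (p j) (p k) > 0"
  have nz: "area (p i) (p j) (p k) \<noteq> 0" if "i < n" "j < n" "k < n" "i \<noteq> j" "i \<noteq> k" "j \<noteq> k" for i j k
    using p that by (intro area_neq_0[OF gp]) (auto simp: radial_enumeration_def bij_betw_def inj_on_def)
  have neg: "area (p i) (p k) (p j) > 0 \<longleftrightarrow> \<not> ?s i j k" if "i < n" "j < n" "k < n" "i \<noteq> j" "i \<noteq> k" "j \<noteq> k" for i j k
    using nz[OF that] area_swap(2)[of "p i" "p j" "p k"] by auto
  have pos: "?s 0 i j" if "0 < i" "i < j" "j < n" for i j
    using p that by (auto simp: radial_enumeration_def)
  \<comment> \<open>For \<open>i = 0\<close> the first three signs are positive, and the last one is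
    then free.\<close>
  have sig: "at_most_one_change (?s i j k) (?s i j l) (?s i k l) (?s j k l)"
    if "i < j" "j < k" "k < l" "l < n" for i j k l
  proof (cases "i = 0")
    case True
    then show ?thesis using pos that by (auto simp: at_most_one_change_def)
  next
    case False
    then show ?thesis
      using signotope_radial_enumeration[OF p] that by (auto simp: signotope_def list_all_iff)
  qed
  have ab: ?thesis if "?s a b c = ?s a b d" "b \<noteq> c" "b \<noteq> d"
    using that idx by (intro closed_segments_disjoint_if_sign_eq nz) auto
  have cd: ?thesis if "?s c d a = ?s c d b" "b \<noteq> c" "b \<noteq> d"
    using that idx closed_segments_disjoint_if_sign_eq[of "p c" "p d" "p a" "p b"] nz[of c d a] nz[of c d b]
    by auto
  consider "b < c" | "d < b" | "c < b" "b < d"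
    using far by (auto simp: far_def split: if_splits)
  then show ?thesis
  proof cases
    case 1
    \<comment> \<open>With at most one change among four signs, the first two or the last two
      agree.\<close>
    then have "?s a b c = ?s a b d \<or> ?s a c d = ?s b c d"
      using sig[of a b c d] idx unfolding at_most_one_change_def by auto
    then show ?thesis using ab cd 1 idx area_rotate[of "p c" "p d" "p a"] area_rotate[of "p c" "p d" "p b"] by auto
  next
    case 2
    then have "?s a c b = ?s a d b"
      using far idx pos[of c b] pos[of d b] by (auto simp: far_def split: if_splits)
    then show ?thesis using ab 2 idx neg[of a c b] neg[of a d b] by auto
  next
    case 3
    have "\<not> (?s a c b = ?s a c d \<and> ?s a c d = ?s a b d \<and> ?s a b d = ?s c b d)"
      using far 3 idx pos[of c d] pos[of c b] pos[of b d] by (auto simp: far_def split: if_splits)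
    \<comment> \<open>The four signs change exactly once, so the first differs from the third or the
      second from the fourth. Swapping two arguments turns such a difference into agreement of
      sides.\<close>
    then have "?s a c b \<noteq> ?s a b d \<or> ?s a c d \<noteq> ?s c b d"
      using sig[of a c b d] 3 idx unfolding at_most_one_change_def by auto
    then show ?thesis
      using ab cd 3 idx neg[of a c b] neg[of c b d] area_rotate[of "p c" "p d" "p a"] by auto
  qed
qed

lemma hamiltonian_on_edges_if_pairs:
  assumes gp: "general_position P" and p: "radial_enumeration p n P"
    and ham: "hamiltonian_on (index_apart (\<lambda>i j k. area (p i) (p j) (p k) > 0)) (set (pairs n))"
  shows "hamiltonian_on apart (edges P)"
proof -
  let ?f = "\<lambda>(i, j). {p i, p j}"
  have bij: "bij_betw ?f (set (pairs n)) (edges P)"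
    using p by (intro bij_betw_pairs_edges) (simp add: radial_enumeration_def)
  have "apart (?f e) (?f f)" if ef: "e \<in> set (pairs n)" "f \<in> set (pairs n)"
      "index_apart (\<lambda>i j k. area (p i) (p j) (p k) > 0) e f" for e f
  proof -
    obtain a b c d where eq: "e = (a, b)" "f = (c, d)" by (cases e; cases f) auto
    then have "a < b" "b < n" "c < d" "d < n" using ef by (auto simp: set_pairs)
    moreover have "a < c \<and> far (\<lambda>i j k. area (p i) (p j) (p k) > 0) a b c d \<or>
        c < a \<and> far (\<lambda>i j k. area (p i) (p j) (p k) > 0) c d a b"
      using ef(3) eq by (auto simp: index_apart_def split: if_splits)
    ultimately have "closed_segment (p a) (p b) \<inter> closed_segment (p c) (p d) = {}"
      using far_imp_disjoint[OF gp p, of a b c d] far_imp_disjoint[OF gp p, of c d a b] by blast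
    then show ?thesis by (simp add: eq apart_doubleton)
  qed
  then have "hamiltonian_on apart (?f ` set (pairs n))"
    using bij ham by (intro hamiltonian_on_image) (auto simp: bij_betw_def)
  then show ?thesis using bij by (simp add: bij_betw_def)
qed

section \<open>Six points in convex position\<close>

text \<open>With all signs positive, \<open>far\<close> fails only for a common endpoint or for
  interleaved indices a < c < b < d, and interleaved chords of a convex polygon cross.\<close>

lemma edges_meet_if_not_index_apart:
  fixes p :: "nat \<Rightarrow> real^2"
  assumes p: "bij_betw p {..<n} P"
    and pos: "\<And>i j k. i < j \<Longrightarrow> j < k \<Longrightarrow> k < n \<Longrightarrow> area (p i) (p j) (p k) > 0"
    and idx: "a < b" "b < n" "c < d" "d < n" "a < c"
    and far: "\<not> far (\<lambda>_ _ _. True) a b c d"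
  shows "\<not> apart {p a, p b} {p c, p d}"
proof (cases "b = c \<or> b = d")
  case True
  then show ?thesis using apart_imp_disjoint by fastforce
next
  case False
  then have "c < b" "b < d" using far by (auto simp: far_def split: if_splits)
  then have "area (p a) (p c) (p b) > 0" "area (p a) (p b) (p d) > 0"
    "area (p a) (p c) (p d) > 0" "area (p c) (p b) (p d) > 0"
    using idx by (auto intro!: pos)
  then have "area (p a) (p b) (p c) * area (p a) (p b) (p d) < 0"
    "area (p c) (p d) (p a) * area (p c) (p d) (p b) < 0"
    using area_swap(2)[of "p a" "p c" "p b"] area_swap(2)[of "p c" "p b" "p d"] area_rotate[of "p c" "p d" "p a"]
    by (auto simp: mult_less_0_iff)
  then show ?thesis
    using closed_segments_meet by (simp add: apart_doubleton)
qed

lemma not_hamiltonian_convex_hexagon: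
  fixes p :: "nat \<Rightarrow> real^2"
  assumes p: "bij_betw p {..<6} P"
    and pos: "\<And>i j k. i < j \<Longrightarrow> j < k \<Longrightarrow> k < 6 \<Longrightarrow> area (p i) (p j) (p k) > 0"
  shows "\<not> hamiltonian_on apart (edges P)"
proof
  assume "hamiltonian_on apart (edges P)"
  moreover have "index_apart (\<lambda>_ _ _. True) e f"
    if ef: "e \<in> set (pairs 6)" "f \<in> set (pairs 6)"
      and ap: "apart ((\<lambda>(i, j). {p i, p j}) e) ((\<lambda>(i, j). {p i, p j}) f)" for e f
  proof (rule ccontr)
    assume not: "\<not> index_apart (\<lambda>_ _ _. True) e f"
    obtain a b c d where eq: "e = (a, b)" "f = (c, d)" by (cases e; cases f) auto
    then have idx: "a < b" "b < 6" "c < d" "d < 6" using ef by (auto simp: set_pairs)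
    have ap': "apart {p a, p b} {p c, p d}" "apart {p c, p d} {p a, p b}"
      using ap eq sympD[OF symp_apart] by auto
    consider "a < c" | "c < a" | "a = c" by linarith
    then show False
    proof cases
      case 1
      then show False
        using edges_meet_if_not_index_apart[OF p pos idx] not eq ap' by (simp add: index_apart_def)
    next
      case 2
      then show False
        using edges_meet_if_not_index_apart[OF p pos idx(3,4,1,2)] not eq ap' by (simp add: index_apart_def)
    next
      case 3
      then show False using apart_imp_disjoint[OF ap'(1)] by auto
    qed
  qed
  ultimately have "hamiltonian_on (index_apart (\<lambda>_ _ _. True)) (set (pairs 6))"
    using hamiltonian_on_bij_betw[OF bij_betw_pairs_edges[OF p]] by blast
  then show False using not_hamiltonian_on_hexagon by blast
qed

lemma not_hamiltonian_on_edges_small: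
  assumes "finite P" "card P \<in> {2, 3, 4, 5}"
  shows "\<not> hamiltonian_on apart (edges P)"
proof
  assume ham: "hamiltonian_on apart (edges P)"
  obtain p where p: "bij_betw p {..<card P} P"
    using ex_bij_betw_nat_finite[OF assms(1)] by (auto simp: atLeast0LessThan)
  have "no_common_index e f"
    if "apart ((\<lambda>(i, j). {p i, p j}) e) ((\<lambda>(i, j). {p i, p j}) f)" for e f :: "nat \<times> nat"
    using apart_imp_disjoint[OF that] by (cases e; cases f) (auto simp: no_common_index_def)
  then have "hamiltonian_on no_common_index (set (pairs (card P)))"
    using hamiltonian_on_bij_betw[OF bij_betw_pairs_edges[OF p] _ ham] by blast
  then show False using not_hamiltonian_on_kneser[OF assms(2)] by blast
qed

text \<open>Seen from \<open>q\<close>, the point \<open>b\<close> lies between \<open>a\<close> and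
  \<open>c\<close>. If \<open>a b c\<close> did not turn left, \<open>b\<close> would lie in the
  triangle \<open>q a c\<close>.\<close>

lemma area_pos_if_convex_position:
  assumes gp: "general_position Q" and conv: "convex_position Q"
    and Q: "q \<in> Q" "a \<in> Q" "b \<in> Q" "c \<in> Q"
    and pos: "area q a b > 0" "area q a c > 0" "area q b c > 0"
  shows "area a b c > 0"
proof (rule ccontr)
  assume "\<not> area a b c > 0"
  have ne: "q \<noteq> a" "q \<noteq> b" "q \<noteq> c" "a \<noteq> b" "a \<noteq> c" "b \<noteq> c"
    using pos by (auto simp: area_def)
  let ?D = "area q a c"
  \<comment> \<open>Barycentric coordinates of \<open>b\<close> with respect to \<open>q\<close>,
    \<open>a\<close> and \<open>c\<close>.\<close>
  let ?u = "- area a b c / ?D" and ?v = "area q b c / ?D" and ?w = "area q a b / ?D"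
  have "b = ?u *\<^sub>R q + ?v *\<^sub>R a + ?w *\<^sub>R c"
  proof -
    have "?D * b$i = - area a b c * q$i + area q b c * a$i + area q a b * c$i" if "i = 1 \<or> i = 2" for i
      using that by (auto simp: area_def algebra_simps)
    then have "b$i = ?u * q$i + ?v * a$i + ?w * c$i" if "i = 1 \<or> i = 2" for i
      using that pos(2) by (simp add: field_simps)
    then show ?thesis by (auto simp: vec_eq_iff forall_2)
  qed
  moreover have "?u \<ge> 0" "?v \<ge> 0" "?w \<ge> 0"
    using pos \<open>\<not> area a b c > 0\<close> by (auto simp: divide_le_0_iff)
  moreover have "?u + ?v + ?w = 1"
  proof -
    have "- area a b c + area q b c + area q a b = ?D" by (simp add: area_def algebra_simps)
    moreover have "?u + ?v + ?w = (- area a b c + area q b c + area q a b) / ?D"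
      by (simp only: add_divide_distrib)
    ultimately show ?thesis using pos(2) by simp
  qed
  ultimately have "b \<in> convex hull {q, a, c}"
    unfolding convex_hull_3 by blast
  also have "convex hull {q, a, c} \<subseteq> convex hull (Q - {b})"
    using Q ne by (intro hull_mono) auto
  finally show False using conv Q by (auto simp: convex_position_def)
qed

text \<open>The line through the two cyclic neighbours of a point strictly separates it from the
  closed half-plane that contains all other points.\<close>

lemma convex_position_if_area_pos:
  fixes p :: "nat \<Rightarrow> real^2"
  assumes p: "bij_betw p {..<n} P" and n: "3 \<le> n"
    and pos: "\<And>i j k. i < j \<Longrightarrow> j < k \<Longrightarrow> k < n \<Longrightarrow> area (p i) (p j) (p k) > 0"
  shows "convex_position P"
proof -
  have separated: "x \<notin> convex hull (P - {x})"
    if "area a b x < 0" "\<And>y. y \<in> P - {x} \<Longrightarrow> area a b y \<ge> 0" for a b x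
  proof -
    have "convex {y. area a b y \<ge> 0}"
      by (auto simp: convex_alt area_convex_combination)
    then have "convex hull (P - {x}) \<subseteq> {y. area a b y \<ge> 0}"
      using that(2) by (intro hull_minimal) auto
    then show ?thesis using that(1) by auto
  qed
  have "p m \<notin> convex hull (P - {p m})" if m: "m < n" for m
  proof -
    \<comment> \<open>The neighbours wrap around at both ends: they are n - 1 and 1 for the first
      point, n - 2 and 0 for the last.\<close>
    consider "m = 0" | "0 < m" "Suc m < n" | "0 < m" "Suc m = n" using m by linarith
    then obtain i j where ij: "area (p i) (p j) (p m) < 0"
        "\<And>k. k < n \<Longrightarrow> k \<noteq> m \<Longrightarrow> area (p i) (p j) (p k) \<ge> 0"
    proof cases
      case 1
      have "area (p (n - 1)) (p 1) (p m) = - area (p 0) (p 1) (p (n - 1))"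
        using 1 by (simp add: area_def algebra_simps)
      also have "\<dots> < 0" using pos[of 0 1 "n - 1"] n by simp
      finally have neg: "area (p (n - 1)) (p 1) (p m) < 0" .
      have "area (p (n - 1)) (p 1) (p k) \<ge> 0" if k: "k < n" "k \<noteq> m" for k
      proof -
        consider "k = 1" | "k = n - 1" | "1 < k" "k < n - 1" using k 1 by linarith
        then show ?thesis
          using pos[of 1 k "n - 1"] n area_rotate[of "p 1" "p k" "p (n - 1)"] by cases auto
      qed
      with neg show ?thesis by (rule that)
    next
      case 2
      then obtain l where l: "m = l + 1" "l + 2 < n" by (cases m) auto
      have "area (p l) (p (l + 2)) (p m) = - area (p l) (p (l + 1)) (p (l + 2))"
        unfolding l(1) by (rule area_swap)
      also have "\<dots> < 0" using pos[of l "l + 1" "l + 2"] l(2) by simp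
      finally have neg: "area (p l) (p (l + 2)) (p m) < 0" .
      have "area (p l) (p (l + 2)) (p k) \<ge> 0" if k: "k < n" "k \<noteq> m" for k
      proof -
        consider "k < l" | "k = l" | "k = l + 2" | "l + 2 < k" using k l(1) by linarith
        then show ?thesis
        proof cases
          case 1
          then have "area (p k) (p l) (p (l + 2)) > 0" using l(2) by (intro pos) auto
          then show ?thesis by (subst area_rotate) (rule less_imp_le)
        next
          case 2
          then show ?thesis by (simp only: area_same order_refl)
        next
          case 3
          then show ?thesis by (simp only: area_same order_refl)
        next
          case 4
          then have "area (p l) (p (l + 2)) (p k) > 0" using k by (intro pos) auto
          then show ?thesis by (rule less_imp_le)
        qed
      qed
      with neg show ?thesis by (rule that)
    next
      case 3
      then obtain l where l: "m = l + 1" "n = l + 2" by (cases m) auto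
      have "area (p l) (p 0) (p m) = - area (p 0) (p l) (p m)"
        by (rule area_swap)
      also have "\<dots> < 0" using pos[of 0 l m] l n by simp
      finally have neg: "area (p l) (p 0) (p m) < 0" .
      have "area (p l) (p 0) (p k) \<ge> 0" if k: "k < n" "k \<noteq> m" for k
      proof -
        consider "k = 0" | "k = l" | "0 < k" "k < l" using k l by linarith
        then show ?thesis
        proof cases
          case 1
          then show ?thesis by (simp only: area_same order_refl)
        next
          case 2
          then show ?thesis by (simp only: area_same order_refl)
        next
          case 3
          then have "area (p 0) (p k) (p l) > 0" using l(2) by (intro pos) auto
          then show ?thesis by (subst area_rotate[symmetric]) (rule less_imp_le)
        qed
      qed
      with neg show ?thesis by (rule that)
    qed
    show ?thesis
    proof (rule separated[OF ij(1)])
      fix y assume "y \<in> P - {p m}"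
      then obtain k where "k < n" "y = p k" "k \<noteq> m" using p by (auto simp: bij_betw_def)
      then show "area (p i) (p j) y \<ge> 0" using ij(2) by simp
    qed
  qed
  moreover have "P = p ` {..<n}" using p by (simp add: bij_betw_def)
  ultimately show ?thesis by (auto simp: convex_position_def)
qed

section \<open>Hamiltonicity\<close>

text \<open>Inserting a point works once the enlarged set has 9 points, so both 7 and 8 are base
  cases.\<close>

lemma hamiltonian_on_edges_large:
  assumes "finite P" "general_position P" "7 \<le> card P"
  shows "hamiltonian_on apart (edges P)"
  using assms
proof (induction "card P" arbitrary: P rule: less_induct)
  case less
  note gp = \<open>general_position P\<close>
  obtain p where p: "radial_enumeration p (card P) P"
    using exists_radial_enumeration[OF less.prems(1) gp refl] less.prems(3) by auto
  note sig = signotope_radial_enumeration[OF p]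
  consider "card P = 7" | "card P = 8" | "9 \<le> card P" using less.prems(3) by linarith
  then show ?case
  proof cases
    case 1
    show ?thesis
      by (rule hamiltonian_on_edges_if_pairs[OF gp p[unfolded 1] hamiltonian_on_pairs_7[OF sig[unfolded 1]]])
  next
    case 2
    show ?thesis
      by (rule hamiltonian_on_edges_if_pairs[OF gp p[unfolded 2] hamiltonian_on_pairs_8[OF sig[unfolded 2]]])
  next
    case 3
    then obtain q where q: "q \<in> P" by fastforce
    then have card: "card (P - {q}) = card P - 1" by simp
    have "hamiltonian_on apart (edges (P - {q}))"
    proof (rule less.hyps)
      show "general_position (P - {q})" using gp by (simp add: general_position_def)
    qed (use 3 less.prems(1) card in auto)
    then show ?thesis
      by (rule hamiltonian_on_edges_insert_point[OF less.prems(1) gp 3 q])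
  qed
qed

lemma hamiltonian_on_edges_6:
  assumes fin: "finite P" and gp: "general_position P" and card: "card P = 6"
    and conv: "\<not> convex_position P"
  shows "hamiltonian_on apart (edges P)"
proof -
  obtain p where p: "radial_enumeration p 6 P"
    using exists_radial_enumeration[OF fin gp card] by auto
  have "\<not> list_all (\<lambda>k. list_all (\<lambda>j. list_all (\<lambda>i. area (p i) (p j) (p k) > 0) [1..<j]) [1..<k]) [1..<6]"
  proof
    assume all: "list_all (\<lambda>k. list_all (\<lambda>j. list_all (\<lambda>i. area (p i) (p j) (p k) > 0) [1..<j]) [1..<k]) [1..<6]"
    have "area (p i) (p j) (p k) > 0" if "i < j" "j < k" "k < 6" for i j k
    proof (cases "i = 0")
      case True
      then show ?thesis using p that by (simp add: radial_enumeration_def)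
    next
      case False
      then show ?thesis using all that by (simp add: list_all_iff)
    qed
    moreover have "bij_betw p {..<6} P" "(3::nat) \<le> 6" using p by (simp_all add: radial_enumeration_def)
    ultimately have "convex_position P" using convex_position_if_area_pos[of p 6 P] by blast
    with conv show False ..
  qed
  then show ?thesis
    by (intro hamiltonian_on_edges_if_pairs[OF gp p] hamiltonian_on_pairs_6 signotope_radial_enumeration[OF p])
qed

text \<open>The signs at the hull vertex of \<open>P\<close> carry over to \<open>Q\<close>, where
  convex position forces the remaining ones to be positive. Carried back, they make \<open>P\<close>
  a convex hexagon in the order of its enumeration.\<close>

lemma not_hamiltonian_on_edges_if_convex_order_type:
  assumes Q: "finite Q" "card Q = 6" "general_position Q" "convex_position Q"
    and type: "same_order_type P Q" and gp: "general_position P" and fin: "finite P"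
  shows "\<not> hamiltonian_on apart (edges P)"
proof -
  obtain g where g: "bij_betw g P Q"
      "\<And>a b c. a \<in> P \<Longrightarrow> b \<in> P \<Longrightarrow> c \<in> P \<Longrightarrow> orientation a b c = orientation (g a) (g b) (g c)"
    using type by (auto simp: same_order_type_def)
  then have "card P = 6" using Q(2) bij_betw_same_card by metis
  then obtain p where p: "radial_enumeration p 6 P"
    using exists_radial_enumeration[OF fin gp] by auto
  have P: "p i \<in> P" if "i < 6" for i using p that by (auto simp: radial_enumeration_def bij_betw_def)
  have gQ: "g (p i) \<in> Q" if "i < 6" for i using P[OF that] g(1) by (auto simp: bij_betw_def)
  have iff: "area (p i) (p j) (p k) > 0 \<longleftrightarrow> area (g (p i)) (g (p j)) (g (p k)) > 0"
    if "i < 6" "j < 6" "k < 6" for i j k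
    using g(2)[OF P P P, OF that] by (metis orientation_eq_sgn_area sgn_greater)
  have pos: "area (p i) (p j) (p k) > 0" if ijk: "i < j" "j < k" "k < 6" for i j k
  proof (cases "i = 0")
    case True
    then show ?thesis using p ijk by (simp add: radial_enumeration_def)
  next
    case False
    have "area (g (p 0)) (g (p i)) (g (p j)) > 0" "area (g (p 0)) (g (p i)) (g (p k)) > 0"
      "area (g (p 0)) (g (p j)) (g (p k)) > 0"
      using iff[of 0 i j] iff[of 0 i k] iff[of 0 j k] p False ijk by (simp_all add: radial_enumeration_def)
    from area_pos_if_convex_position[OF Q(3,4) gQ[of 0] gQ[of i] gQ[of j] gQ[of k] this]
    show ?thesis using iff[of i j k] ijk by simp
  qed
  have "bij_betw p {..<6} P" using p by (simp add: radial_enumeration_def)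
  then show ?thesis using pos by (rule not_hamiltonian_convex_hexagon)
qed

theorem theorem1:
  fixes P :: "(real^2) set" and n :: nat
  assumes "finite P" and "card P = n" and "n \<ge> 2" and "general_position P"
  shows "hamiltonian (edge_disjointness_graph P) \<longleftrightarrow>
    n \<ge> 6 \<and>
    \<not> (\<exists>Q. finite Q \<and> card Q = 6 \<and> general_position Q \<and> convex_position Q \<and>
          same_order_type P Q)"
  unfolding hamiltonian_iff_edges
proof
  assume ham: "hamiltonian_on apart (edges P)"
  then have "n \<notin> {2, 3, 4, 5}"
    using not_hamiltonian_on_edges_small[OF assms(1)] assms(2) by blast
  then have "n \<ge> 6" using assms(3) by auto
  then show "n \<ge> 6 \<and> \<not> (\<exists>Q. finite Q \<and> card Q = 6 \<and> general_position Q \<and> convex_position Q \<and>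
      same_order_type P Q)"
    using not_hamiltonian_on_edges_if_convex_order_type[OF _ _ _ _ _ assms(4,1)] ham by blast
next
  assume asm: "n \<ge> 6 \<and> \<not> (\<exists>Q. finite Q \<and> card Q = 6 \<and> general_position Q \<and> convex_position Q \<and>
      same_order_type P Q)"
  show "hamiltonian_on apart (edges P)"
  proof (cases "n = 6")
    case True
    \<comment> \<open>If \<open>P\<close> were in convex position, it would itself serve as the
      excluded \<open>Q\<close>.\<close>
    have "same_order_type P P"
      unfolding same_order_type_def by (intro exI[of _ id]) auto
    with asm True assms have "\<not> convex_position P" by blast
    then show ?thesis using hamiltonian_on_edges_6 assms True by blast
  next
    case False
    then show ?thesis using hamiltonian_on_edges_large[OF assms(1,4)] asm assms(2) by simp
  qed
qed

end
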